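(* For every integer $n\geq 3$ there is a finite number $N_2=N_2(n)$ with the following property. Every strictly 2-overlapping family $\mathcal{K}$ of $N_2$ convex sets in $\mathbb{R}^3$ contains a sequence $K_1,\ldots,K_n$ of $n$ distinct sets that is realized by a monotone sequence $\ell_1,\ldots,\ell_n$ of lines in $\mathbb{R}^3$.
   Context: For $p\in\mathbb{R}^3$ let $p^*\in\mathbb{R}^2$ be its vertical projection (dropping the last coordinate), and for $A\subseteq\mathbb{R}^3$ let $A^*=\{p^*:p\in A\}$. A family $\mathcal{K}$ of convex sets in $\mathbb{R}^3$ is strictly 2-overlapping if $\{K^*:K\in\mathcal{K}\}$ is strictly 2-intersecting, i.e. any two of the projected sets intersect but no three distinct ones have a common point. A sequence $K_1,\ldots,K_n$ of convex sets in $\mathbb{R}^3$ is realized by a sequence $\ell_1,\ldots,\ell_n$ of non-vertical lines in $\mathbb{R}^3$ with pairwise non-parallel projections if for all $1\leq i<j\leq n$ the projected segments $(K_i\cap\ell_i)^*$ and $(K_j\cap\ell_j)^*$ intersect (equivalently, the unique vertical line meeting $\ell_i$ and $\ell_j$ meets them within $K_i\cap\ell_i$ and $K_j\cap\ell_j$). For two non-vertical lines $\ell_1,\ell_2$ in $\mathbb{R}^3$ with non-parallel projections, let $p(\ell_1,\ell_2)$ (resp. $p(\ell_2,\ell_1)$) be the intersection point of $\ell_1$ (resp. $\ell_2$) with the unique vertical line meeting both $\ell_1$ and $\ell_2$. Write $\ell_1\prec\ell_2$ (resp. $\ell_1\succ\ell_2$) if $p(\ell_1,\ell_2)$ lies strictly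 below (resp. above) $p(\ell_2,\ell_1)$, and $\ell_1\preceq\ell_2$ (resp. $\ell_1\succeq\ell_2$) if $\ell_1\prec\ell_2$ (resp. $\ell_1\succ\ell_2$) or $\ell_1\cap\ell_2\neq\emptyset$. An ordered sequence of $n\geq 3$ non-vertical lines in $\mathbb{R}^2$, no three through a common point, is an $n$-cap (resp. $n$-cup) if the slopes are strictly decreasing (resp. increasing) and for all $i<j<k$ the point $\ell_i\cap\ell_k$ lies above (resp. below) $\ell_j$. A sequence $\ell_1,\ldots,\ell_n$ ($n\geq3$) of non-vertical lines in $\mathbb{R}^3$ is monotone if (1) the projected sequence $\ell_1^*,\ldots,\ell_n^*$ is an $n$-cap or an $n$-cup, and (2) either $\ell_1\preceq\ell_2\preceq\cdots\preceq\ell_n$ or $\ell_1\succeq\ell_2\succeq\cdots\succeq\ell_n$. *)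

theory Defs
  imports "HOL-Analysis.Analysis"
begin

definition proj :: "real^3 \<Rightarrow> real^2" where
  "proj p = vector [p $ 1, p $ 2]"

text \<open>
  The family is indexed: ``distinct'' refers to the index, not to the value. For the projections
  of a family of sets in space this means that two different sets with the same projection count
  as two members.
\<close>

definition strictly_2_intersecting :: "'i set \<Rightarrow> ('i \<Rightarrow> 'a set) \<Rightarrow> bool" where
  "strictly_2_intersecting I F \<longleftrightarrow>
     (\<forall>i\<in>I. \<forall>j\<in>I. i \<noteq> j \<longrightarrow> F i \<inter> F j \<noteq> {}) \<and>
     (\<forall>i\<in>I. \<forall>j\<in>I. \<forall>k\<in>I. i \<noteq> j \<and> i \<noteq> k \<and> j \<noteq> k \<longrightarrow> F i \<inter> F j \<inter> F k = {})"

definition strictly_2_overlapping :: "(real^3) set set \<Rightarrow> bool" where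
  "strictly_2_overlapping \<K> \<longleftrightarrow> strictly_2_intersecting \<K> (\<lambda>K. proj ` K)"

definition is_line :: "'a::euclidean_space set \<Rightarrow> bool" where
  "is_line L \<longleftrightarrow> affine L \<and> aff_dim L = 1"

definition vertical_line3 :: "(real^3) set \<Rightarrow> bool" where
  "vertical_line3 L \<longleftrightarrow> (\<exists>a b. L = {p. p $ 1 = a \<and> p $ 2 = b})"

definition vertical_line2 :: "(real^2) set \<Rightarrow> bool" where
  "vertical_line2 L \<longleftrightarrow> (\<exists>a. L = {q. q $ 1 = a})"

definition nonvertical_line3 :: "(real^3) set \<Rightarrow> bool" where
  "nonvertical_line3 L \<longleftrightarrow> is_line L \<and> \<not> vertical_line3 L"

definition nonvertical_line2 :: "(real^2) set \<Rightarrow> bool" where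
  "nonvertical_line2 L \<longleftrightarrow> is_line L \<and> \<not> vertical_line2 L"

text \<open>Sequences of length \<open>n\<close> are functions on \<open>nat\<close>, restricted to the indices \<open>1, \<dots>, n\<close>.\<close>

definition realized_by ::
  "nat \<Rightarrow> (nat \<Rightarrow> (real^3) set) \<Rightarrow> (nat \<Rightarrow> (real^3) set) \<Rightarrow> bool" where
  "realized_by n K l \<longleftrightarrow>
     (\<forall>i\<in>{1..n}. nonvertical_line3 (l i)) \<and>
     (\<forall>i\<in>{1..n}. \<forall>j\<in>{1..n}. i < j \<longrightarrow>
        \<not> affine_parallel (proj ` l i) (proj ` l j) \<and>
        proj ` (K i \<inter> l i) \<inter> proj ` (K j \<inter> l j) \<noteq> {})"

text \<open>
  The following is meaningful only for non-vertical lines with non-parallel projections, for which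
  both definite descriptions have a unique witness.
\<close>

definition common_vertical :: "(real^3) set \<Rightarrow> (real^3) set \<Rightarrow> (real^3) set" where
  "common_vertical l1 l2 = (THE v. vertical_line3 v \<and> v \<inter> l1 \<noteq> {} \<and> v \<inter> l2 \<noteq> {})"

definition crossing_point :: "(real^3) set \<Rightarrow> (real^3) set \<Rightarrow> real^3" where
  "crossing_point l1 l2 = (THE p. p \<in> l1 \<inter> common_vertical l1 l2)"

definition line_below :: "(real^3) set \<Rightarrow> (real^3) set \<Rightarrow> bool" where
  "line_below l1 l2 \<longleftrightarrow> crossing_point l1 l2 $ 3 < crossing_point l2 l1 $ 3"

definition line_above :: "(real^3) set \<Rightarrow> (real^3) set \<Rightarrow> bool" where
  "line_above l1 l2 \<longleftrightarrow> crossing_point l1 l2 $ 3 > crossing_point l2 l1 $ 3"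

definition line_below_eq :: "(real^3) set \<Rightarrow> (real^3) set \<Rightarrow> bool" where
  "line_below_eq l1 l2 \<longleftrightarrow> line_below l1 l2 \<or> l1 \<inter> l2 \<noteq> {}"

definition line_above_eq :: "(real^3) set \<Rightarrow> (real^3) set \<Rightarrow> bool" where
  "line_above_eq l1 l2 \<longleftrightarrow> line_above l1 l2 \<or> l1 \<inter> l2 \<noteq> {}"

definition slope :: "(real^2) set \<Rightarrow> real" where
  "slope L = (THE m. \<exists>b. L = {q. q $ 2 = m * q $ 1 + b})"

definition point_above_line :: "real^2 \<Rightarrow> (real^2) set \<Rightarrow> bool" where
  "point_above_line q L \<longleftrightarrow> (\<exists>r\<in>L. r $ 1 = q $ 1 \<and> r $ 2 < q $ 2)"

definition point_below_line :: "real^2 \<Rightarrow> (real^2) set \<Rightarrow> bool" where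
  "point_below_line q L \<longleftrightarrow> (\<exists>r\<in>L. r $ 1 = q $ 1 \<and> q $ 2 < r $ 2)"

definition simple_lines :: "nat \<Rightarrow> (nat \<Rightarrow> (real^2) set) \<Rightarrow> bool" where
  "simple_lines n L \<longleftrightarrow>
     (\<forall>i\<in>{1..n}. nonvertical_line2 (L i)) \<and>
     (\<forall>i\<in>{1..n}. \<forall>j\<in>{1..n}. \<forall>k\<in>{1..n}. i < j \<and> j < k \<longrightarrow> L i \<inter> L j \<inter> L k = {})"

definition is_cap :: "nat \<Rightarrow> (nat \<Rightarrow> (real^2) set) \<Rightarrow> bool" where
  "is_cap n L \<longleftrightarrow> n \<ge> 3 \<and> simple_lines n L \<and>
     (\<forall>i\<in>{1..n}. \<forall>j\<in>{1..n}. i < j \<longrightarrow> slope (L i) > slope (L j)) \<and>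
     (\<forall>i\<in>{1..n}. \<forall>j\<in>{1..n}. \<forall>k\<in>{1..n}. i < j \<and> j < k \<longrightarrow>
        (\<exists>q. L i \<inter> L k = {q} \<and> point_above_line q (L j)))"

definition is_cup :: "nat \<Rightarrow> (nat \<Rightarrow> (real^2) set) \<Rightarrow> bool" where
  "is_cup n L \<longleftrightarrow> n \<ge> 3 \<and> simple_lines n L \<and>
     (\<forall>i\<in>{1..n}. \<forall>j\<in>{1..n}. i < j \<longrightarrow> slope (L i) < slope (L j)) \<and>
     (\<forall>i\<in>{1..n}. \<forall>j\<in>{1..n}. \<forall>k\<in>{1..n}. i < j \<and> j < k \<longrightarrow>
        (\<exists>q. L i \<inter> L k = {q} \<and> point_below_line q (L j)))"

text \<open>
  The relations \<open>line_below_eq\<close> and \<open>line_above_eq\<close> are not transitive; a chain of them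
  relates consecutive lines only.
\<close>

definition monotone_lines :: "nat \<Rightarrow> (nat \<Rightarrow> (real^3) set) \<Rightarrow> bool" where
  "monotone_lines n l \<longleftrightarrow> n \<ge> 3 \<and>
     (\<forall>i\<in>{1..n}. nonvertical_line3 (l i)) \<and>
     (is_cap n (\<lambda>i. proj ` l i) \<or> is_cup n (\<lambda>i. proj ` l i)) \<and>
     ((\<forall>i\<in>{1..<n}. line_below_eq (l i) (l (i + 1))) \<or>
      (\<forall>i\<in>{1..<n}. line_above_eq (l i) (l (i + 1))))"

end

theory Submission
  imports Defs "HOL-Library.Ramsey"
begin

text \<open>
  The problem reduces to the plane: if segments inside the projected sets cross pairwise, then lifting
  their endpoints gives segments inside the original sets, because a lifted segment stays in its set and
  still projects onto the whole planar segment. Sorting the lines by slope and applying Ramsey's theorem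
  first to triples (cap or cup) and then to pairs (below or above) yields a monotone sequence.

  In the plane, make the sets compact and order them by their leftmost abscissae. By Ramsey's theorem
  one may assume that either every crossing of \<open>K\<^sub>i\<close> and \<open>K\<^sub>j\<close> lies to the left of \<open>K\<^sub>k\<close> for all
  \<open>i < j < k\<close>, or any two sets meet to the right of a vertical line that meets them all. In the first
  case the segments from a point of \<open>K\<^sub>0 \<inter> K\<^sub>j\<close> to a point of \<open>K\<^sub>j\<close> on a vertical line further right
  cross pairwise. In the second case the same argument from the right confines all crossings to a
  vertical slab. If the orders of the sets on the two sides of the slab do not agree, transversal
  segments cross; if they agree, one may assume by Ramsey's theorem that for \<open>i < k < j\<close> the
  crossing of \<open>K\<^sub>i\<close> and \<open>K\<^sub>j\<close> lies below \<open>K\<^sub>k\<close>, and then segments from points of \<open>K\<^sub>0 \<inter> K\<^sub>j\<close> to one side of the slab cross: such a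
  point cannot lie above a segment in \<open>K\<^sub>i\<close>, as it would then belong to the three sets \<open>K\<^sub>0\<close>, \<open>K\<^sub>i\<close>
  and \<open>K\<^sub>j\<close>.
\<close>

subsection \<open>Homogeneous subsequences\<close>

definition increasing_into :: "nat \<Rightarrow> nat \<Rightarrow> (nat \<Rightarrow> nat) \<Rightarrow> bool" where
  "increasing_into m N f \<longleftrightarrow> (\<forall>i<m. f i < N) \<and> (\<forall>i j. i < j \<and> j < m \<longrightarrow> f i < f j)"

lemma increasing_intoD:
  assumes "increasing_into m N f"
  shows "\<forall>i<m. f i < N" "i < j \<Longrightarrow> j < m \<Longrightarrow> f i < f j" "inj_on f {..<m}"
proof -
  show "\<forall>i<m. f i < N" and less: "i < j \<Longrightarrow> j < m \<Longrightarrow> f i < f j" for i j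
    using assms by (auto simp: increasing_into_def)
  then show "inj_on f {..<m}"
    by (intro linorder_inj_onI) (auto simp: less_imp_neq)
qed

text \<open>A predicate on ordered triples colours a 3-set through its increasing enumeration, so
  Ramsey's theorem for two colours applies. \<open>N\<close> is quantified before \<open>P\<close>
  so that it can be fixed before any geometric data are known.\<close>

lemma ramsey_triples:
  fixes m :: nat
  shows "\<exists>N. \<forall>P::nat \<Rightarrow> nat \<Rightarrow> nat \<Rightarrow> bool. \<exists>f b. increasing_into m N f \<and>
     (\<forall>i j k. i < j \<and> j < k \<and> k < m \<longrightarrow> P (f i) (f j) (f k) = b)"
proof -
  obtain N :: nat where N: "partn_lst {..<N} [m, m] 3"
    using ramsey_full by blast
  show ?thesis
  proof (intro exI[of _ N] allI)
    fix P :: "nat \<Rightarrow> nat \<Rightarrow> nat \<Rightarrow> bool"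
    define col :: "nat set \<Rightarrow> nat" where
      "col S = (if \<exists>i j k. i < j \<and> j < k \<and> S = {i, j, k} \<and> P i j k then 1 else 0)" for S
    have "col \<in> nsets {..<N} 3 \<rightarrow> {..<2}"
      by (auto simp: col_def)
    then obtain c H where c: "c < 2" and H: "H \<in> nsets {..<N} ([m, m] ! c)"
      and hom: "col ` nsets H 3 \<subseteq> {c}"
      by (rule partn_lstE[OF N]) (auto simp: numeral_2_eq_2)
    have "[m, m] ! c = m"
      using c by (auto simp: less_2_cases_iff)
    then have Hm: "H \<subseteq> {..<N}" "finite H" "card H = m"
      using H by (auto simp: nsets_def)
    define f where "f = nth (sorted_list_of_set H)"
    have len: "length (sorted_list_of_set H) = m"
      using Hm by simp
    have fH: "f i \<in> H" if "i < m" for i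
      using that Hm len unfolding f_def by (metis nth_mem set_sorted_list_of_set)
    have f_less: "f i < f j" if "i < j" "j < m" for i j
      using that len unfolding f_def
      by (metis Hm(2) sorted_wrt_nth_less strict_sorted_list_of_set)
    have "P (f i) (f j) (f k) = (c = 1)" if ijk: "i < j" "j < k" "k < m" for i j k
    proof -
      have less: "f i < f j" "f j < f k"
        using f_less ijk by auto
      have "{f i, f j, f k} \<in> nsets H 3"
        using fH ijk less by (auto simp: nsets_def)
      then have "col {f i, f j, f k} = c"
        using hom by blast
      \<comment> \<open>The increasing enumeration of a three-element set is unique, so the
        existential in \<open>col\<close> can only be witnessed by the triple at hand.\<close>
      moreover have "(\<exists>a b c. a < b \<and> b < c \<and> {f i, f j, f k} = {a, b, c} \<and> P a b c) = P (f i) (f j) (f k)"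
      proof -
        have "a = f i \<and> b = f j \<and> c = f k"
          if "a < b" "b < c" and eq: "{f i, f j, f k} = {a, b, c}" for a b c
        proof -
          have "sorted_list_of_set {f i, f j, f k} = [f i, f j, f k]"
            using less by auto
          moreover have "sorted_list_of_set {a, b, c} = [a, b, c]"
            using that by auto
          ultimately have "[f i, f j, f k] = [a, b, c]"
            by (simp only: eq)
          then show ?thesis
            by simp
        qed
        then show ?thesis
          using less by metis
      qed
      ultimately show ?thesis
        by (auto simp: col_def)
    qed
    moreover have "\<forall>i<m. f i < N"
      using fH Hm(1) by auto
    ultimately show "\<exists>f b. increasing_into m N f \<and>
     (\<forall>i j k. i < j \<and> j < k \<and> k < m \<longrightarrow> P (f i) (f j) (f k) = b)"
      using f_less by (intro exI[of _ f] exI[of _ "c = 1"]) (simp add: increasing_into_def)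
  qed
qed

text \<open>A predicate on pairs is a predicate on triples that ignores its last argument. The extra
  index \<open>m\<close> supplies that argument for every pair below \<open>m\<close>.\<close>

lemma ramsey_pairs:
  fixes m :: nat
  shows "\<exists>N. \<forall>P::nat \<Rightarrow> nat \<Rightarrow> bool. \<exists>f b. increasing_into m N f \<and>
     (\<forall>i j. i < j \<and> j < m \<longrightarrow> P (f i) (f j) = b)"
proof -
  obtain N where N: "\<forall>P::nat \<Rightarrow> nat \<Rightarrow> nat \<Rightarrow> bool. \<exists>f b. increasing_into (Suc m) N f \<and>
     (\<forall>i j k. i < j \<and> j < k \<and> k < Suc m \<longrightarrow> P (f i) (f j) (f k) = b)"
    by (rule exE[OF ramsey_triples])
  show ?thesis
  proof (intro exI[of _ N] allI)
    fix P :: "nat \<Rightarrow> nat \<Rightarrow> bool"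
    obtain f b where f: "increasing_into (Suc m) N f"
      and hom: "\<forall>i j k. i < j \<and> j < k \<and> k < Suc m \<longrightarrow> P (f i) (f j) = b"
      using spec[OF N, of "\<lambda>i j k. P i j"] by blast
    have "P (f i) (f j) = b" if "i < j" "j < m" for i j
      using spec[OF spec[OF spec[OF hom, of i], of j], of m] that by simp
    then show "\<exists>f b. increasing_into m N f \<and>
       (\<forall>i j. i < j \<and> j < m \<longrightarrow> P (f i) (f j) = b)"
      using f by (intro exI[of _ f] exI[of _ b]) (simp add: increasing_into_def)
  qed
qed

lemma ex_sorting_bij:
  fixes x :: "nat \<Rightarrow> 'a::linorder"
  shows "\<exists>f. bij_betw f {..<m} {..<m} \<and> (\<forall>i j. i < j \<and> j < m \<longrightarrow> x (f i) \<le> x (f j))"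
proof (intro exI conjI allI impI)
  let ?xs = "sort_key x [0..<m]"
  show "bij_betw (nth ?xs) {..<m} {..<m}"
    by (rule bij_betw_nth) auto
  fix i j assume "i < j \<and> j < m"
  moreover have "sorted (map x ?xs)"
    by simp
  ultimately show "x (?xs ! i) \<le> x (?xs ! j)"
    by (metis (no_types, lifting) length_map length_sort length_upt diff_zero less_imp_le less_trans nth_map sorted_nth_mono)
qed

lemma inj_on_lessThan_compose:
  fixes f g :: "nat \<Rightarrow> nat"
  assumes "inj_on g {..<M}" "inj_on f {..<m}" "\<forall>i<m. f i < M"
  shows "inj_on (\<lambda>i. g (f i)) {..<m}"
  by (rule inj_onI) (metis assms inj_onD lessThan_iff)

subsection \<open>Pairwise crossing segments in the plane\<close>

lemma fst_in_closed_segment: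
  fixes p q :: "real \<times> real"
  assumes "fst p \<le> x" "x \<le> fst q"
  obtains z where "z \<in> closed_segment p q" "fst z = x"
proof -
  have "connected (fst ` closed_segment p q)"
    by (intro connected_continuous_image continuous_intros) auto
  then have "x \<in> fst ` closed_segment p q"
    by (rule connectedD_interval[of _ "fst p" "fst q"]) (use assms in auto)
  then show ?thesis
    using that by blast
qed

text \<open>Points with the same parameter have the same abscissa on both segments, so the
  intermediate value theorem for the difference of heights gives a crossing. The bound on
  \<open>fst z\<close> serves to locate the crossing relative to other sets of a family.\<close>

lemma segments_cross:
  fixes a a' b b' :: "real \<times> real"
  assumes "fst a = fst b" "fst a' = fst b'" "snd a \<le> snd b" "snd b' \<le> snd a'" "fst a \<le> fst a'"
  obtains z where "z \<in> closed_segment a a'" "z \<in> closed_segment b b'" "fst a \<le> fst z"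
proof -
  let ?A = "\<lambda>t. (1 - t) *\<^sub>R a + t *\<^sub>R a'" and ?B = "\<lambda>t. (1 - t) *\<^sub>R b + t *\<^sub>R b'"
  have "\<exists>t\<ge>0. t \<le> 1 \<and> snd (?A t) - snd (?B t) = 0"
    using assms by (intro IVT'[of "\<lambda>t. snd (?A t) - snd (?B t)"] continuous_intros) auto
  then obtain t where t: "0 \<le> t" "t \<le> 1" "snd (?A t) = snd (?B t)"
    by auto
  then have "?A t = ?B t"
    using assms by (auto simp: prod_eq_iff)
  moreover have "fst a \<le> fst (?A t)"
    using mult_left_mono[OF assms(5) t(1)] by (simp add: algebra_simps)
  ultimately show ?thesis
    using t that[of "?A t"] unfolding closed_segment_def by blast
qed

lemma convex_vertical_between:
  fixes K :: "(real \<times> real) set"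
  assumes "convex K" "a \<in> K" "b \<in> K" "fst a = fst p" "fst b = fst p" "snd a \<le> snd p" "snd p \<le> snd b"
  shows "p \<in> K"
proof -
  \<comment> \<open>The vertical segment from \<open>a\<close> to \<open>b\<close> is made to cross
    the degenerate segment at \<open>p\<close>.\<close>
  obtain z where "z \<in> closed_segment p p" "z \<in> closed_segment a b"
    by (rule segments_cross[of a p b p]) (use assms in auto)
  then show ?thesis
    using closed_segment_subset[OF assms(2,3,1)] by auto
qed

section \<open>Families of planar convex sets, their subfamilies and reflections\<close>

text \<open>Indices form an initial segment of the naturals, so that passing to a subfamily or
  reversing its order is composition with an injection.\<close>

definition convex_family :: "nat \<Rightarrow> (nat \<Rightarrow> (real \<times> real) set) \<Rightarrow> bool" where
  "convex_family N K \<longleftrightarrow> (\<forall>i<N. convex (K i)) \<and> strictly_2_intersecting {..<N} K"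

lemma convex_family_convex: "convex_family N K \<Longrightarrow> i < N \<Longrightarrow> convex (K i)"
  by (simp add: convex_family_def)

lemma convex_family_meet:
  assumes "convex_family N K" "i < N" "j < N" "i \<noteq> j"
  obtains p where "p \<in> K i" "p \<in> K j"
proof -
  have "K i \<inter> K j \<noteq> {}"
    using assms unfolding convex_family_def strictly_2_intersecting_def by simp
  then show ?thesis
    using that by blast
qed

lemma convex_family_no_triple:
  assumes "convex_family N K" "i < N" "j < N" "k < N" "i \<noteq> j" "i \<noteq> k" "j \<noteq> k"
    "p \<in> K i" "p \<in> K j" "p \<in> K k"
  shows False
proof -
  have "K i \<inter> K j \<inter> K k = {}"
    using assms(1-7) unfolding convex_family_def strictly_2_intersecting_def by simp
  then show False
    using assms(8-10) by auto
qed

lemma convex_family_reindex: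
  assumes "convex_family N K" "inj_on f {..<m}" "\<forall>i<m. f i < N"
  shows "convex_family m (\<lambda>i. K (f i))"
proof -
  have "f i \<noteq> f j" if "i < m" "j < m" "i \<noteq> j" for i j
    using that assms(2) by (auto simp: inj_on_def)
  then show ?thesis
    using assms(1,3) unfolding convex_family_def strictly_2_intersecting_def by simp
qed

lemma convex_family_linear_image:
  assumes "convex_family N K" "linear T" "inj T"
  shows "convex_family N (\<lambda>i. T ` K i)"
  using assms by (simp add: convex_family_def strictly_2_intersecting_def convex_linear_image
      flip: image_Int)

text \<open>Endpoints may coincide or lie on one vertical line; such segments are removed only in
  \<open>nonvertical_crossing_segments\<close>. The index set \<open>J\<close> carries no order,
  since the lines are later sorted by slope.\<close>

definition has_crossing_segments :: "nat \<Rightarrow> nat \<Rightarrow> (nat \<Rightarrow> (real \<times> real) set) \<Rightarrow> bool" where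
  "has_crossing_segments n N K \<longleftrightarrow> (\<exists>J c d. J \<subseteq> {..<N} \<and> card J = n \<and>
     (\<forall>i\<in>J. c i \<in> K i \<and> d i \<in> K i) \<and>
     (\<forall>i\<in>J. \<forall>j\<in>J. i \<noteq> j \<longrightarrow> closed_segment (c i) (d i) \<inter> closed_segment (c j) (d j) \<noteq> {}))"

lemma has_crossing_segmentsI:
  assumes "J \<subseteq> {..<N}" "card J = n"
    "\<And>i. i \<in> J \<Longrightarrow> c i \<in> K i" "\<And>i. i \<in> J \<Longrightarrow> d i \<in> K i"
    "\<And>i j. i \<in> J \<Longrightarrow> j \<in> J \<Longrightarrow> i < j \<Longrightarrow> \<exists>z. z \<in> closed_segment (c i) (d i) \<and> z \<in> closed_segment (c j) (d j)"
  shows "has_crossing_segments n N K"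
proof -
  have "closed_segment (c i) (d i) \<inter> closed_segment (c j) (d j) \<noteq> {}"
    if "i \<in> J" "j \<in> J" "i \<noteq> j" for i j
    using that assms(5)[of i j] assms(5)[of j i] by (cases "i < j") auto
  then show ?thesis
    unfolding has_crossing_segments_def
    by (intro exI[of _ J] exI[of _ c] exI[of _ d]) (use assms(1-4) in auto)
qed

lemma has_crossing_segments_mono:
  assumes "has_crossing_segments n N K" "\<And>i. i < N \<Longrightarrow> K i \<subseteq> K' i"
  shows "has_crossing_segments n N K'"
proof -
  obtain J c d where J: "J \<subseteq> {..<N}" "card J = n"
    and cd: "\<forall>i\<in>J. c i \<in> K i \<and> d i \<in> K i"
    and meet: "\<forall>i\<in>J. \<forall>j\<in>J. i \<noteq> j \<longrightarrow> closed_segment (c i) (d i) \<inter> closed_segment (c j) (d j) \<noteq> {}"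
    using assms(1) unfolding has_crossing_segments_def by blast
  have "\<forall>i\<in>J. c i \<in> K' i \<and> d i \<in> K' i"
    using cd J(1) assms(2) by blast
  then show ?thesis
    unfolding has_crossing_segments_def using J meet by blast
qed

lemma has_crossing_segments_reindex:
  assumes "has_crossing_segments n m (\<lambda>i. K (f i))" "inj_on f {..<m}" "\<forall>i<m. f i < N"
  shows "has_crossing_segments n N K"
proof -
  obtain J c d where J: "J \<subseteq> {..<m}" "card J = n"
    and cd: "\<forall>i\<in>J. c i \<in> K (f i) \<and> d i \<in> K (f i)"
    and meet: "\<forall>i\<in>J. \<forall>j\<in>J. i \<noteq> j \<longrightarrow> closed_segment (c i) (d i) \<inter> closed_segment (c j) (d j) \<noteq> {}"
    using assms(1) unfolding has_crossing_segments_def by blast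
  have inj: "inj_on f J"
    using J(1) assms(2) by (rule inj_on_subset[rotated])
  let ?g = "the_inv_into J f"
  have g: "?g (f i) = i" if "i \<in> J" for i
    using the_inv_into_f_f[OF inj that] .
  have "card (f ` J) = n"
    using card_image[OF inj] J(2) by simp
  then show ?thesis
    unfolding has_crossing_segments_def
    by (intro exI[of _ "f ` J"] exI[of _ "\<lambda>i. c (?g i)"] exI[of _ "\<lambda>i. d (?g i)"])
       (use J(1) cd meet assms(3) g in auto)
qed

lemma has_crossing_segments_linear_image:
  assumes "has_crossing_segments n N (\<lambda>i. T ` K i)" "linear T" "inj T"
  shows "has_crossing_segments n N K"
proof -
  obtain J c d where J: "J \<subseteq> {..<N}" "card J = n"
    and cd: "\<forall>i\<in>J. c i \<in> T ` K i \<and> d i \<in> T ` K i"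
    and meet: "\<forall>i\<in>J. \<forall>j\<in>J. i \<noteq> j \<longrightarrow> closed_segment (c i) (d i) \<inter> closed_segment (c j) (d j) \<noteq> {}"
    using assms(1) unfolding has_crossing_segments_def by blast
  have eq: "T (inv T p) = p" if "p \<in> T ` S" for p S
    using that by (auto simp: inv_f_f[OF assms(3)])
  have "closed_segment (inv T (c i)) (inv T (d i)) \<inter> closed_segment (inv T (c j)) (inv T (d j)) \<noteq> {}"
    if "i \<in> J" "j \<in> J" "i \<noteq> j" for i j
  proof -
    have "T ` closed_segment (inv T (c k)) (inv T (d k)) = closed_segment (c k) (d k)" if "k \<in> J" for k
      using cd that eq by (metis assms(2) closed_segment_linear_image)
    then have "T ` (closed_segment (inv T (c i)) (inv T (d i)) \<inter> closed_segment (inv T (c j)) (inv T (d j))) \<noteq> {}"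
      using meet that by (simp add: image_Int[OF assms(3)])
    then show ?thesis by blast
  qed
  moreover have "\<forall>i\<in>J. inv T (c i) \<in> K i \<and> inv T (d i) \<in> K i"
    using cd by (auto simp: inv_f_f[OF assms(3)])
  ultimately show ?thesis
    unfolding has_crossing_segments_def
    by (intro exI[of _ J] exI[of _ "\<lambda>i. inv T (c i)"] exI[of _ "\<lambda>i. inv T (d i)"]) (use J in auto)
qed

text \<open>Reflections reduce mirror images of a case to the case itself: families are pushed
  forward by \<open>convex_family_linear_image\<close> and segments are pulled back by
  \<open>has_crossing_segments_linear_image\<close>.\<close>

definition reflect_fst :: "real \<times> real \<Rightarrow> real \<times> real" where "reflect_fst p = (- fst p, snd p)"
definition reflect_snd :: "real \<times> real \<Rightarrow> real \<times> real" where "reflect_snd p = (fst p, - snd p)"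

lemma reflect_fst [simp]: "linear reflect_fst" "inj reflect_fst"
  "fst (reflect_fst p) = - fst p" "snd (reflect_fst p) = snd p"
  by (auto simp: reflect_fst_def inj_def linear_iff prod_eq_iff)

lemma reflect_snd [simp]: "linear reflect_snd" "inj reflect_snd"
  "fst (reflect_snd p) = fst p" "snd (reflect_snd p) = - snd p"
  by (auto simp: reflect_snd_def inj_def linear_iff prod_eq_iff)

lemma reflect_image_iff [simp]:
  "p \<in> reflect_fst ` S \<longleftrightarrow> reflect_fst p \<in> S" "p \<in> reflect_snd ` S \<longleftrightarrow> reflect_snd p \<in> S"
  by (force simp: reflect_fst_def reflect_snd_def)+

lemma reflect_involution [simp]: "reflect_fst (reflect_fst p) = p" "reflect_snd (reflect_snd p) = p"
  by (simp_all add: reflect_fst_def reflect_snd_def)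

section \<open>Fans of segments ending on a common vertical line\<close>

text \<open>At the abscissa of \<open>q'\<close> the first segment is not below the second, and on
  the common vertical line of \<open>h\<close> and \<open>h'\<close> it is not above it. Hence they
  cross in between.\<close>

lemma fan_cross:
  fixes q q' h h' :: "real \<times> real"
  assumes "z \<in> closed_segment q h" "fst z = fst q'" "snd q' \<le> snd z" "fst h = fst h'"
    "snd h \<le> snd h'" "fst q' \<le> fst h'"
  shows "\<exists>w. w \<in> closed_segment q h \<and> w \<in> closed_segment q' h'"
proof -
  obtain w where "w \<in> closed_segment q' h'" "w \<in> closed_segment z h"
    by (rule segments_cross[of q' z h' h]) (use assms in auto)
  moreover have "closed_segment z h \<subseteq> closed_segment q h"
    using assms(1) by (simp add: subset_closed_segment)
  ultimately show ?thesis
    by blast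
qed

text \<open>Segments run from \<open>q j\<close> in \<open>K 0 \<inter> K j\<close> to
  \<open>h j\<close>. The points \<open>q j\<close> move to the right because each crossing of
  \<open>K 0\<close> with \<open>K i\<close> lies to the left of every later \<open>K j\<close>. The
  set \<open>K 0\<close> serves as base, so \<open>n + 1\<close> sets give \<open>n\<close>
  segments.\<close>

lemma crossing_segments_if_crossings_left:
  assumes fam: "convex_family (Suc n) K"
    and h: "\<And>i. i \<le> n \<Longrightarrow> h i \<in> K i" "\<And>i. i \<le> n \<Longrightarrow> fst (h i) = \<beta>"
    and mono: "\<And>i j. i < j \<Longrightarrow> j \<le> n \<Longrightarrow> snd (h i) \<le> snd (h j)"
    and l: "\<And>j p. j \<le> n \<Longrightarrow> p \<in> K j \<Longrightarrow> l j \<le> fst p"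
    and left: "\<And>i j k p. i < j \<Longrightarrow> j < k \<Longrightarrow> k \<le> n \<Longrightarrow> p \<in> K i \<Longrightarrow> p \<in> K j \<Longrightarrow> fst p < l k"
    and left_\<beta>: "\<And>i j p. i < j \<Longrightarrow> j \<le> n \<Longrightarrow> p \<in> K i \<Longrightarrow> p \<in> K j \<Longrightarrow> fst p < \<beta>"
  shows "has_crossing_segments n (Suc n) K"
proof -
  have "\<exists>p. p \<in> K 0 \<and> p \<in> K j" if "1 \<le> j" "j \<le> n" for j
    using convex_family_meet[OF fam, of 0 j] that by (metis le_imp_less_Suc not_one_le_zero zero_less_Suc)
  then obtain q where q0: "\<And>j. 1 \<le> j \<Longrightarrow> j \<le> n \<Longrightarrow> q j \<in> K 0"
    and q: "\<And>j. 1 \<le> j \<Longrightarrow> j \<le> n \<Longrightarrow> q j \<in> K j"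
    by metis
  have cross: "\<exists>z. z \<in> closed_segment (q i) (h i) \<and> z \<in> closed_segment (q j) (h j)"
    if ij: "1 \<le> i" "i < j" "j \<le> n" for i j
  proof -
    have lj: "l j \<le> fst (q j)"
      using l q ij by simp
    have q\<beta>: "fst (q j) < \<beta>"
      using left_\<beta>[of 0 j] q0 q ij by simp
    have "fst (q i) < l j"
      using left[of 0 i j] q0 q ij by simp
    then obtain z where z: "z \<in> closed_segment (q i) (h i)" "fst z = fst (q j)"
      using fst_in_closed_segment[of "q i" "fst (q j)" "h i"] lj q\<beta> h(2)[of i] ij by auto
    \<comment> \<open>If \<open>q j\<close> were above the segment of \<open>K i\<close>, the
      segment from \<open>q j\<close> to \<open>h 0\<close> would have to pass through that segment,
      since \<open>h 0\<close> is no higher than \<open>h i\<close>. This would give a common point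
      of \<open>K 0\<close> and \<open>K i\<close> that is not to the left of
      \<open>l j\<close>.\<close>
    have "snd (q j) \<le> snd z"
    proof (rule ccontr)
      assume less: "\<not> snd (q j) \<le> snd z"
      obtain w where w: "w \<in> closed_segment z (h i)" "w \<in> closed_segment (q j) (h 0)" "fst z \<le> fst w"
        by (rule segments_cross[of z "q j" "h i" "h 0"])
           (use z less h(2)[of 0] h(2)[of i] mono[of 0 i] q\<beta> ij in auto)
      have "closed_segment (q i) (h i) \<subseteq> K i"
        using convex_family_convex[OF fam] q h ij by (intro closed_segment_subset) auto
      then have "w \<in> K i"
        using w(1) z(1) by (meson ends_in_segment(2) subset_closed_segment subsetD)
      moreover have "w \<in> K 0"
        using w(2) closed_segment_subset[of "q j" "K 0" "h 0"] convex_family_convex[OF fam] q0 h(1)[of 0] ij by auto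
      ultimately have "fst w < l j"
        using left[of 0 i j w] ij by simp
      then show False
        using w(3) z(2) lj by simp
    qed
    then show ?thesis
      using fan_cross[OF z] h(2)[of i] h(2)[of j] mono[of i j] q\<beta> ij by auto
  qed
  show ?thesis
    by (rule has_crossing_segmentsI[of "{1..n}" _ _ q _ h]) (use q h cross in auto)
qed

text \<open>The fan is built as before, but a different reason keeps \<open>q j\<close> from lying
  above the segment in \<open>K i\<close>: convexity would place it between that segment and the
  point provided by \<open>below\<close>, hence in \<open>K 0\<close>, \<open>K i\<close> and
  \<open>K j\<close> at once.\<close>

lemma crossing_segments_if_crossings_below:
  assumes fam: "convex_family (Suc n) K"
    and h: "\<And>i. i \<le> n \<Longrightarrow> h i \<in> K i" "\<And>i. i \<le> n \<Longrightarrow> fst (h i) = \<beta>"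
    and mono: "\<And>i j. i < j \<Longrightarrow> j \<le> n \<Longrightarrow> snd (h i) \<le> snd (h j)"
    and q: "\<And>j. 1 \<le> j \<Longrightarrow> j \<le> n \<Longrightarrow> q j \<in> K 0 \<and> q j \<in> K j \<and> fst (q j) \<le> \<beta>"
    and mono_q: "\<And>i j. 1 \<le> i \<Longrightarrow> i < j \<Longrightarrow> j \<le> n \<Longrightarrow> fst (q i) \<le> fst (q j)"
    and below: "\<And>i j. 1 \<le> i \<Longrightarrow> i < j \<Longrightarrow> j \<le> n \<Longrightarrow>
      \<exists>z\<in>K i. fst z = fst (q j) \<and> snd (q j) \<le> snd z"
  shows "has_crossing_segments n (Suc n) K"
proof -
  have cross: "\<exists>z. z \<in> closed_segment (q i) (h i) \<and> z \<in> closed_segment (q j) (h j)"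
    if ij: "1 \<le> i" "i < j" "j \<le> n" for i j
  proof -
    obtain z where z: "z \<in> closed_segment (q i) (h i)" "fst z = fst (q j)"
      using fst_in_closed_segment[of "q i" "fst (q j)" "h i"] mono_q[OF ij] q[of j] h(2)[of i] ij by auto
    have "closed_segment (q i) (h i) \<subseteq> K i"
      using convex_family_convex[OF fam] q h ij by (intro closed_segment_subset) auto
    then have zK: "z \<in> K i"
      using z by blast
    have "snd (q j) \<le> snd z"
    proof (rule ccontr)
      assume less: "\<not> snd (q j) \<le> snd z"
      obtain z' where "z' \<in> K i" "fst z' = fst (q j)" "snd (q j) \<le> snd z'"
        using below[OF ij] by blast
      then have "q j \<in> K i"
        using convex_vertical_between[of "K i" z z' "q j"] convex_family_convex[OF fam, of i] zK z less ij
        by auto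
      then show False
        using convex_family_no_triple[OF fam, of 0 i j "q j"] q[of j] ij by auto
    qed
    then show ?thesis
      using fan_cross[OF z] h(2)[of i] h(2)[of j] mono[of i j] q[of j] ij by auto
  qed
  show ?thesis
    by (rule has_crossing_segmentsI[of "{1..n}" _ _ q _ h]) (use q h cross in auto)
qed

section \<open>Cutting a family by a vertical line\<close>

text \<open>The sets are ordered by their leftmost abscissae, and triples are coloured by whether
  \<open>K i\<close> and \<open>K j\<close> have a common point not to the left of the leftmost
  abscissa of \<open>K k\<close>. If they always do, the leftmost abscissa of a late set is the cut;
  if they never do, there is a fan.\<close>

lemma cut_left:
  fixes n m :: nat
  shows "\<exists>N. \<forall>K. (\<forall>i<N. compact (K i)) \<and> convex_family N K \<longrightarrow> has_crossing_segments n N K \<or>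
     (\<exists>f \<alpha>. inj_on f {..<m} \<and> (\<forall>i<m. f i < N) \<and> (\<forall>i<m. \<exists>p\<in>K (f i). fst p = \<alpha>) \<and>
        (\<forall>i<m. \<forall>j<m. i \<noteq> j \<longrightarrow> (\<exists>p\<in>K (f i) \<inter> K (f j). \<alpha> \<le> fst p)))"
proof -
  obtain N1 where N1: "\<forall>P::nat \<Rightarrow> nat \<Rightarrow> bool. \<exists>f b. increasing_into (Suc n) N1 f \<and>
     (\<forall>i j. i < j \<and> j < Suc n \<longrightarrow> P (f i) (f j) = b)"
    by (rule exE[OF ramsey_pairs])
  \<comment> \<open>One subfamily has to serve both outcomes: \<open>m\<close> sets for the cut,
    \<open>N1\<close> sets for the fan.\<close>
  define M where "M = max N1 m"
  obtain N2 where N2: "\<forall>P::nat \<Rightarrow> nat \<Rightarrow> nat \<Rightarrow> bool. \<exists>f b. increasing_into (Suc (Suc M)) N2 f \<and>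
     (\<forall>i j k. i < j \<and> j < k \<and> k < Suc (Suc M) \<longrightarrow> P (f i) (f j) (f k) = b)"
    by (rule exE[OF ramsey_triples])
  show ?thesis
  proof (intro exI[of _ N2] allI impI, elim conjE)
    fix K :: "nat \<Rightarrow> (real \<times> real) set"
    assume compact: "\<forall>i<N2. compact (K i)" and fam: "convex_family N2 K"
    \<comment> \<open>With at least two members, each set meets another one and is nonempty;
      compactness then gives it a leftmost point.\<close>
    have "1 < N2"
    proof -
      obtain f b where "increasing_into (Suc (Suc M)) N2 f"
        using spec[OF N2, of "\<lambda>i j k. True"] by blast
      then have "f 0 < f 1" "f 1 < N2"
        by (auto simp: increasing_into_def)
      then show ?thesis by simp
    qed
    have nonempty: "K i \<noteq> {}" if i: "i < N2" for i
    proof -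
      have "(if i = 0 then 1 else 0) < N2" "i \<noteq> (if i = 0 then 1 else 0)"
        using \<open>1 < N2\<close> by auto
      then obtain p where "p \<in> K i"
        using convex_family_meet[OF fam i] by blast
      then show ?thesis
        by blast
    qed
    have "\<exists>e\<in>K i. \<forall>p\<in>K i. fst e \<le> fst p" if "i < N2" for i
      by (rule continuous_attains_inf) (use compact nonempty that in \<open>auto intro!: continuous_intros\<close>)
    then obtain e where e: "\<And>i. i < N2 \<Longrightarrow> e i \<in> K i" "\<And>i p. i < N2 \<Longrightarrow> p \<in> K i \<Longrightarrow> fst (e i) \<le> fst p"
      by metis
    obtain s where s: "bij_betw s {..<N2} {..<N2}"
      and sorted: "\<And>i j. i < j \<Longrightarrow> j < N2 \<Longrightarrow> fst (e (s i)) \<le> fst (e (s j))"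
      using ex_sorting_bij[of N2 "\<lambda>i. fst (e i)"] by blast
    obtain t b where t: "increasing_into (Suc (Suc M)) N2 t" and
      hom: "\<forall>i j k. i < j \<and> j < k \<and> k < Suc (Suc M) \<longrightarrow>
        (\<exists>p\<in>K (s (t i)) \<inter> K (s (t j)). fst (e (s (t k))) \<le> fst p) = b"
      using spec[OF N2, of "\<lambda>i j k. \<exists>p\<in>K (s i) \<inter> K (s j). fst (e (s k)) \<le> fst p"] by blast
    define g where "g i = s (t i)" for i
    have sN: "s i < N2" if "i < N2" for i
      using bij_betwE[OF s] that by auto
    have gN: "g i < N2" if "i \<le> Suc M" for i
      unfolding g_def using sN increasing_intoD(1)[OF t] that by auto
    have g_inj: "inj_on g {..<Suc (Suc M)}"
      unfolding g_def
      by (rule inj_on_lessThan_compose[OF bij_betw_imp_inj_on[OF s] increasing_intoD(3,1)[OF t]])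
    have g_sorted: "fst (e (g i)) \<le> fst (e (g j))" if "i < j" "j \<le> Suc M" for i j
      unfolding g_def using sorted[of "t i" "t j"] increasing_intoD(1,2)[OF t] that by auto
    let ?\<alpha> = "fst (e (g M))"
    \<comment> \<open>The set with index \<open>M\<close> has no point to the left of
      \<open>?\<alpha>\<close>, so a set that starts no later and meets it has a point on the line
      at \<open>?\<alpha>\<close>.\<close>
    have "\<exists>p\<in>K (g i). fst p = ?\<alpha>" if iM: "i < M" for i
    proof -
      have "g i \<noteq> g M"
        using inj_onD[OF g_inj, of i M] iM by auto
      then obtain p where p: "p \<in> K (g i)" "p \<in> K (g M)"
        using convex_family_meet[OF fam gN gN, of i M] iM by (metis Suc_n_not_le_n le_SucI less_imp_le nat_le_linear)
      obtain z where "z \<in> closed_segment (e (g i)) p" "fst z = ?\<alpha>"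
        using fst_in_closed_segment[of "e (g i)" ?\<alpha> p] g_sorted[OF iM] e(2)[OF gN p(2)] by auto
      moreover have "closed_segment (e (g i)) p \<subseteq> K (g i)"
        using convex_family_convex[OF fam gN] e(1)[OF gN] p iM by (intro closed_segment_subset) auto
      ultimately show ?thesis
        by blast
    qed
    then obtain h where h: "\<And>i. i < M \<Longrightarrow> h i \<in> K (g i)" "\<And>i. i < M \<Longrightarrow> fst (h i) = ?\<alpha>"
      by metis
    have mM: "m \<le> M" "N1 \<le> M"
      by (auto simp: M_def)
    show "has_crossing_segments n N2 K \<or>
     (\<exists>f \<alpha>. inj_on f {..<m} \<and> (\<forall>i<m. f i < N2) \<and> (\<forall>i<m. \<exists>p\<in>K (f i). fst p = \<alpha>) \<and>
        (\<forall>i<m. \<forall>j<m. i \<noteq> j \<longrightarrow> (\<exists>p\<in>K (f i) \<inter> K (f j). \<alpha> \<le> fst p)))"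
    proof (cases b)
      case True
      have right: "\<exists>p\<in>K (g i) \<inter> K (g j). ?\<alpha> \<le> fst p" if "i < j" "j < m" for i j
        using hom[rule_format, of i j M] that mM True unfolding g_def by simp
      have "\<exists>p\<in>K (g i) \<inter> K (g j). ?\<alpha> \<le> fst p" if "i < m" "j < m" "i \<noteq> j" for i j
        using right[of i j] right[of j i] that by (cases "i < j") auto
      moreover have "inj_on g {..<m}"
        using g_inj mM by (auto intro: inj_on_subset)
      moreover have "\<exists>p\<in>K (g i). fst p = ?\<alpha>" if "i < m" for i
        using h that mM by (intro bexI[of _ "h i"]) auto
      ultimately show ?thesis
        using gN mM by (intro disjI2 exI[of _ g] exI[of _ ?\<alpha>]) auto
    next
      case False
      then have left: "fst p < fst (e (g k))"
        if "i < j" "j < k" "k \<le> Suc M" "p \<in> K (g i)" "p \<in> K (g j)" for i j k p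
        using hom[rule_format, of i j k] that unfolding g_def by (auto simp: not_le)
      \<comment> \<open>A second use of Ramsey's theorem makes the heights on the line at
        \<open>?\<alpha>\<close> monotone; decreasing heights become increasing under
        \<open>reflect_snd\<close>.\<close>
      obtain r c where r: "increasing_into (Suc n) N1 r"
        and r_hom: "\<forall>i j. i < j \<and> j < Suc n \<longrightarrow> (snd (h (r i)) \<le> snd (h (r j))) = c"
        using spec[OF N1, of "\<lambda>i j. snd (h i) \<le> snd (h j)"] by blast
      have rM: "r i < M" if "i \<le> n" for i
        using increasing_intoD(1)[OF r] mM that by (metis le_imp_less_Suc order_less_le_trans)
      have gr: "inj_on (\<lambda>i. g (r i)) {..<Suc n}" "\<forall>i<Suc n. g (r i) < N2"
        using inj_on_lessThan_compose[OF g_inj increasing_intoD(3)[OF r]] rM gN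
        by (simp_all add: less_Suc_eq_le less_imp_le le_SucI)
      define H where "H i = K (g (r i))" for i
      have famH: "convex_family (Suc n) H"
        unfolding H_def using convex_family_reindex[OF fam gr] .
      have H_left: "fst p < fst (e (g (r k)))"
        if "i < j" "j < k" "k \<le> n" "p \<in> H i" "p \<in> H j" for i j k p
        using left[of "r i" "r j" "r k" p] increasing_intoD(2)[OF r] rM[of k] that by (auto simp: H_def)
      have H_left': "fst p < ?\<alpha>" if "i < j" "j \<le> n" "p \<in> H i" "p \<in> H j" for i j p
        using left[of "r i" "r j" M p] increasing_intoD(2)[OF r] rM[of j] that by (auto simp: H_def)
      have hH: "h (r i) \<in> H i" "fst (h (r i)) = ?\<alpha>" if "i \<le> n" for i
        using h rM that by (auto simp: H_def)
      have eH: "fst (e (g (r j))) \<le> fst p" if "j \<le> n" "p \<in> H j" for j p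
        using e(2) gr(2) that by (auto simp: H_def)
      have "has_crossing_segments n (Suc n) H"
      proof (cases c)
        case True
        show ?thesis
          by (rule crossing_segments_if_crossings_left[OF famH, of "\<lambda>i. h (r i)" ?\<alpha> "\<lambda>i. fst (e (g (r i)))"])
             (use hH eH H_left H_left' r_hom True in auto)
      next
        case False
        have "has_crossing_segments n (Suc n) (\<lambda>i. reflect_snd ` H i)"
        proof (rule crossing_segments_if_crossings_left[of _ _ "\<lambda>i. reflect_snd (h (r i))" ?\<alpha> "\<lambda>i. fst (e (g (r i)))"])
          show "convex_family (Suc n) (\<lambda>i. reflect_snd ` H i)"
            using convex_family_linear_image[OF famH] by simp
          show "fst (e (g (r j))) \<le> fst p" if "j \<le> n" "p \<in> reflect_snd ` H j" for j p
            using eH[of j "reflect_snd p"] that by simp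
          show "fst p < fst (e (g (r k)))"
            if "i < j" "j < k" "k \<le> n" "p \<in> reflect_snd ` H i" "p \<in> reflect_snd ` H j" for i j k p
            using H_left[of i j k "reflect_snd p"] that by simp
          show "fst p < ?\<alpha>"
            if "i < j" "j \<le> n" "p \<in> reflect_snd ` H i" "p \<in> reflect_snd ` H j" for i j p
            using H_left'[of i j "reflect_snd p"] that by simp
          show "snd (reflect_snd (h (r i))) \<le> snd (reflect_snd (h (r j)))" if "i < j" "j \<le> n" for i j
            using r_hom[rule_format, of i j] that False by simp
        qed (use hH in auto)
        then show ?thesis
          by (rule has_crossing_segments_linear_image) auto
      qed
      then show ?thesis
        using has_crossing_segments_reindex[OF _ gr] unfolding H_def by blast
    qed
  qed
qed

section \<open>Families that traverse a vertical slab\<close>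

text \<open>The sets have the same order on both boundary lines. The crossings \<open>q\<close> are
  fixed data because the colourings below depend on the chosen points; only \<open>q i j\<close>
  with \<open>i < j\<close> is constrained.\<close>

definition layered_slab :: "nat \<Rightarrow> (nat \<Rightarrow> (real \<times> real) set) \<Rightarrow> real \<Rightarrow> real \<Rightarrow>
    (nat \<Rightarrow> real \<times> real) \<Rightarrow> (nat \<Rightarrow> real \<times> real) \<Rightarrow> (nat \<Rightarrow> nat \<Rightarrow> real \<times> real) \<Rightarrow> bool" where
  "layered_slab N K \<alpha> \<beta> a h q \<longleftrightarrow> convex_family N K \<and>
     (\<forall>i<N. a i \<in> K i \<and> fst (a i) = \<alpha> \<and> h i \<in> K i \<and> fst (h i) = \<beta>) \<and>
     (\<forall>i j. i < j \<and> j < N \<longrightarrow> snd (a i) \<le> snd (a j) \<and> snd (h i) \<le> snd (h j)) \<and>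
     (\<forall>i j. i < j \<and> j < N \<longrightarrow> q i j \<in> K i \<and> q i j \<in> K j \<and> \<alpha> \<le> fst (q i j) \<and> fst (q i j) \<le> \<beta>)"

lemma layered_slab_reindex:
  assumes "layered_slab N K \<alpha> \<beta> a h q" "increasing_into m N f"
  shows "layered_slab m (\<lambda>i. K (f i)) \<alpha> \<beta> (\<lambda>i. a (f i)) (\<lambda>i. h (f i)) (\<lambda>i j. q (f i) (f j))"
  using assms convex_family_reindex[of N K f m] increasing_intoD[OF assms(2)]
  unfolding layered_slab_def by simp

text \<open>The points \<open>q 0 j\<close> start a fan with base \<open>K 0\<close>. If their
  abscissae increase along a subsequence, the segments go to the right boundary; if they decrease,
  \<open>reflect_fst\<close> turns the left boundary into the right one.\<close>

lemma crossing_segments_layered_below: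
  fixes n :: nat
  shows "\<exists>N. \<forall>K \<alpha> \<beta> a h q. layered_slab N K \<alpha> \<beta> a h q \<and>
     (\<forall>i k j. i < k \<and> k < j \<and> j < N \<longrightarrow> (\<exists>z\<in>K k. fst z = fst (q i j) \<and> snd (q i j) \<le> snd z))
     \<longrightarrow> has_crossing_segments n N K"
proof -
  obtain N where N: "\<forall>P::nat \<Rightarrow> nat \<Rightarrow> bool. \<exists>f b. increasing_into n N f \<and>
     (\<forall>i j. i < j \<and> j < n \<longrightarrow> P (f i) (f j) = b)"
    by (rule exE[OF ramsey_pairs])
  show ?thesis
  proof (intro exI[of _ "Suc N"] allI impI, elim conjE)
    fix K \<alpha> \<beta> a h q
    assume slab: "layered_slab (Suc N) K \<alpha> \<beta> a h q" and
      below: "\<forall>i k j. i < k \<and> k < j \<and> j < Suc N \<longrightarrow> (\<exists>z\<in>K k. fst z = fst (q i j) \<and> snd (q i j) \<le> snd z)"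
    obtain f b where f: "increasing_into n N f" and
      hom: "\<forall>i j. i < j \<and> j < n \<longrightarrow> (fst (q 0 (Suc (f i))) \<le> fst (q 0 (Suc (f j)))) = b"
      using spec[OF N, of "\<lambda>i j. fst (q 0 (Suc i)) \<le> fst (q 0 (Suc j))"] by blast
    \<comment> \<open>Index 0 is kept for the base and \<open>f\<close> selects among the positive
      indices; hence \<open>Suc N\<close> sets.\<close>
    define g where "g i = (if i = 0 then 0 else Suc (f (i - 1)))" for i
    have "f (i - 1) < f (j - 1)" if "0 < i" "i < j" "j < Suc n" for i j
      using increasing_intoD(2)[OF f, of "i - 1" "j - 1"] that by auto
    then have g: "increasing_into (Suc n) (Suc N) g"
      using increasing_intoD(1)[OF f] by (auto simp: increasing_into_def g_def)
    define H where "H i = K (g i)" for i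
    have slabH: "layered_slab (Suc n) H \<alpha> \<beta> (\<lambda>i. a (g i)) (\<lambda>i. h (g i)) (\<lambda>i j. q (g i) (g j))"
      unfolding H_def by (rule layered_slab_reindex[OF slab g])
    have fam: "convex_family (Suc n) H"
      and a: "\<And>i. i \<le> n \<Longrightarrow> a (g i) \<in> H i" "\<And>i. i \<le> n \<Longrightarrow> fst (a (g i)) = \<alpha>"
      and h: "\<And>i. i \<le> n \<Longrightarrow> h (g i) \<in> H i" "\<And>i. i \<le> n \<Longrightarrow> fst (h (g i)) = \<beta>"
      and mono: "\<And>i j. i < j \<Longrightarrow> j \<le> n \<Longrightarrow> snd (a (g i)) \<le> snd (a (g j))"
        "\<And>i j. i < j \<Longrightarrow> j \<le> n \<Longrightarrow> snd (h (g i)) \<le> snd (h (g j))"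
      and q': "\<And>i j. i < j \<Longrightarrow> j \<le> n \<Longrightarrow> q (g i) (g j) \<in> H i \<and> q (g i) (g j) \<in> H j \<and>
        \<alpha> \<le> fst (q (g i) (g j)) \<and> fst (q (g i) (g j)) \<le> \<beta>"
      using slabH unfolding layered_slab_def by (auto simp: less_Suc_eq_le)
    have q: "\<And>j. 1 \<le> j \<Longrightarrow> j \<le> n \<Longrightarrow> q 0 (g j) \<in> H 0" "\<And>j. 1 \<le> j \<Longrightarrow> j \<le> n \<Longrightarrow> q 0 (g j) \<in> H j"
        "\<And>j. 1 \<le> j \<Longrightarrow> j \<le> n \<Longrightarrow> \<alpha> \<le> fst (q 0 (g j))" "\<And>j. 1 \<le> j \<Longrightarrow> j \<le> n \<Longrightarrow> fst (q 0 (g j)) \<le> \<beta>"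
      using q'[of 0] by (simp_all add: g_def[of 0])
    have belowH: "\<exists>z\<in>H i. fst z = fst (q 0 (g j)) \<and> snd (q 0 (g j)) \<le> snd z"
      if "1 \<le> i" "i < j" "j \<le> n" for i j
    proof -
      have "0 < g i" "g i < g j" "g j < Suc N"
        using increasing_intoD(2)[OF g, of 0 i] increasing_intoD(2)[OF g, of i j] increasing_intoD(1)[OF g] that
        by (auto simp: g_def[of 0])
      then show ?thesis
        using below[rule_format, of 0 "g i" "g j"] by (simp add: H_def)
    qed
    have hom': "(fst (q 0 (g i)) \<le> fst (q 0 (g j))) = b" if "1 \<le> i" "i < j" "j \<le> n" for i j
    proof -
      have "i - 1 < j - 1 \<and> j - 1 < n"
        using that by auto
      then show ?thesis
        using hom that by (simp add: g_def)
    qed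
    have "has_crossing_segments n (Suc n) H"
    proof (cases b)
      case True
      show ?thesis
        by (rule crossing_segments_if_crossings_below[OF fam, of "\<lambda>i. h (g i)" \<beta> "\<lambda>j. q 0 (g j)"])
           (use h mono q belowH hom' True in auto)
    next
      case False
      have "has_crossing_segments n (Suc n) (\<lambda>i. reflect_fst ` H i)"
      proof (rule crossing_segments_if_crossings_below[of _ _ "\<lambda>i. reflect_fst (a (g i))" "- \<alpha>" "\<lambda>j. reflect_fst (q 0 (g j))"])
        show "convex_family (Suc n) (\<lambda>i. reflect_fst ` H i)"
          using convex_family_linear_image[OF fam] by simp
        show "fst (reflect_fst (q 0 (g i))) \<le> fst (reflect_fst (q 0 (g j)))"
          if "1 \<le> i" "i < j" "j \<le> n" for i j
          using hom'[OF that] False by simp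
        show "\<exists>z\<in>reflect_fst ` H i. fst z = fst (reflect_fst (q 0 (g j))) \<and> snd (reflect_fst (q 0 (g j))) \<le> snd z"
          if "1 \<le> i" "i < j" "j \<le> n" for i j
          using belowH[OF that] by auto
      qed (use a mono q in auto)
      then show ?thesis
        by (rule has_crossing_segments_linear_image) auto
    qed
    then show "has_crossing_segments n (Suc N) K"
      using has_crossing_segments_reindex[OF _ increasing_intoD(3,1)[OF g]] unfolding H_def by blast
  qed
qed

text \<open>Triples are coloured by whether the middle set has a point at or above the crossing of
  the outer two. Since every set spans the slab, failure means that the middle set passes strictly
  below the crossing, which is the first case upside down.\<close>

lemma crossing_segments_layered:
  fixes n :: nat
  shows "\<exists>N. \<forall>K \<alpha> \<beta> a h q. layered_slab N K \<alpha> \<beta> a h q \<longrightarrow> has_crossing_segments n N K"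
proof -
  obtain m where m: "\<forall>K \<alpha> \<beta> a h q. layered_slab m K \<alpha> \<beta> a h q \<and>
     (\<forall>i k j. i < k \<and> k < j \<and> j < m \<longrightarrow> (\<exists>z\<in>K k. fst z = fst (q i j) \<and> snd (q i j) \<le> snd z))
     \<longrightarrow> has_crossing_segments n m K"
    by (rule exE[OF crossing_segments_layered_below])
  obtain N where N: "\<forall>P::nat \<Rightarrow> nat \<Rightarrow> nat \<Rightarrow> bool. \<exists>f b. increasing_into m N f \<and>
     (\<forall>i j k. i < j \<and> j < k \<and> k < m \<longrightarrow> P (f i) (f j) (f k) = b)"
    by (rule exE[OF ramsey_triples])
  show ?thesis
  proof (intro exI[of _ N] allI impI)
    fix K \<alpha> \<beta> a h q
    assume slab: "layered_slab N K \<alpha> \<beta> a h q"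
    obtain f b where f: "increasing_into m N f" and
      hom: "\<forall>i k j. i < k \<and> k < j \<and> j < m \<longrightarrow>
        (\<exists>z\<in>K (f k). fst z = fst (q (f i) (f j)) \<and> snd (q (f i) (f j)) \<le> snd z) = b"
      using spec[OF N, of "\<lambda>i k j. \<exists>z\<in>K k. fst z = fst (q i j) \<and> snd (q i j) \<le> snd z"] by blast
    have slabf: "layered_slab m (\<lambda>i. K (f i)) \<alpha> \<beta> (\<lambda>i. a (f i)) (\<lambda>i. h (f i)) (\<lambda>i j. q (f i) (f j))"
      by (rule layered_slab_reindex[OF slab f])
    have "has_crossing_segments n m (\<lambda>i. K (f i))"
    proof (cases b)
      case True
      then show ?thesis
        using m[rule_format, OF conjI, OF slabf] hom by blast
    next
      case False
      \<comment> \<open>Reflection reverses the order of the layers; reversing the indices restores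
        it and exchanges the arguments of \<open>q\<close>.\<close>
      define r where "r i = m - Suc i" for i
      have r: "r i < m" "r j < r i" if "i < j" "j < m" for i j
        using that by (auto simp: r_def)
      have r_inj: "inj_on r {..<m}" and r_m: "\<forall>i<m. r i < m"
        by (auto simp: r_def inj_on_def)
      let ?K = "\<lambda>i. reflect_snd ` K (f (r i))"
      have fam: "convex_family m (\<lambda>i. K (f i))"
        using slabf by (simp add: layered_slab_def)
      have "convex_family m ?K"
        using convex_family_linear_image[OF convex_family_reindex[OF fam r_inj r_m]] by simp
      then have slabr: "layered_slab m ?K \<alpha> \<beta> (\<lambda>i. reflect_snd (a (f (r i)))) (\<lambda>i. reflect_snd (h (f (r i))))
        (\<lambda>i j. reflect_snd (q (f (r j)) (f (r i))))"
        using slabf r r_m unfolding layered_slab_def by simp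
      have belowr: "\<exists>z\<in>?K k. fst z = fst (reflect_snd (q (f (r j)) (f (r i)))) \<and>
          snd (reflect_snd (q (f (r j)) (f (r i)))) \<le> snd z" if "i < k" "k < j" "j < m" for i k j
      proof -
        let ?q = "q (f (r j)) (f (r i))"
        have order: "r j < r k" "r k < r i" "r i < m"
          using r r_m that by auto
        have aK: "a (f (r k)) \<in> K (f (r k))" "fst (a (f (r k))) = \<alpha>"
          and hK: "h (f (r k)) \<in> K (f (r k))" "fst (h (f (r k))) = \<beta>"
          and qK: "\<alpha> \<le> fst ?q" "fst ?q \<le> \<beta>"
          using slabf order unfolding layered_slab_def by auto
        obtain z where z: "z \<in> closed_segment (a (f (r k))) (h (f (r k)))" "fst z = fst ?q"
          using fst_in_closed_segment[of "a (f (r k))" "fst ?q" "h (f (r k))"] aK hK qK by auto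
        moreover have "closed_segment (a (f (r k))) (h (f (r k))) \<subseteq> K (f (r k))"
          using convex_family_convex[OF fam] aK hK order by (intro closed_segment_subset) auto
        ultimately have "z \<in> K (f (r k))"
          by blast
        moreover have "\<not> snd ?q \<le> snd z"
          using hom[rule_format, of "r j" "r k" "r i"] order False z(2) \<open>z \<in> K (f (r k))\<close> by blast
        ultimately show ?thesis
          using z(2) by (intro bexI[of _ "reflect_snd z"]) auto
      qed
      have "has_crossing_segments n m ?K"
        by (rule m[rule_format, OF conjI, OF slabr]) (use belowr in blast)
      then have "has_crossing_segments n m (\<lambda>i. K (f (r i)))"
        by (rule has_crossing_segments_linear_image) auto
      then show ?thesis
        by (rule has_crossing_segments_reindex[OF _ r_inj r_m])
    qed
    then show "has_crossing_segments n N K"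
      by (rule has_crossing_segments_reindex[OF _ increasing_intoD(3,1)[OF f]])
  qed
qed

text \<open>The sets are sorted by height on the right line, and Ramsey's theorem compares this with
  the order on the left line. Agreement gives a layered slab; disagreement makes the segments from
  line to line cross outright.\<close>

lemma crossing_segments_slab:
  fixes n :: nat
  shows "\<exists>N. \<forall>K \<alpha> \<beta>. convex_family N K \<and> (\<forall>i<N. \<exists>p\<in>K i. fst p = \<alpha>) \<and> (\<forall>i<N. \<exists>p\<in>K i. fst p = \<beta>) \<and>
     (\<forall>i<N. \<forall>j<N. i \<noteq> j \<longrightarrow> (\<exists>p\<in>K i \<inter> K j. \<alpha> \<le> fst p \<and> fst p \<le> \<beta>)) \<longrightarrow> has_crossing_segments n N K"
proof -
  obtain m0 where m0: "\<forall>K \<alpha> \<beta> a h q. layered_slab m0 K \<alpha> \<beta> a h q \<longrightarrow> has_crossing_segments n m0 K"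
    by (rule exE[OF crossing_segments_layered])
  \<comment> \<open>\<open>m0\<close> sets serve the layered case and \<open>n\<close> sets the
    reversed one; the summand 2 guarantees a pair, whose crossing shows
    \<open>\<alpha> \<le> \<beta>\<close>.\<close>
  define m where "m = m0 + n + 2"
  obtain N where N: "\<forall>P::nat \<Rightarrow> nat \<Rightarrow> bool. \<exists>f b. increasing_into m N f \<and>
     (\<forall>i j. i < j \<and> j < m \<longrightarrow> P (f i) (f j) = b)"
    by (rule exE[OF ramsey_pairs])
  show ?thesis
  proof (intro exI[of _ N] allI impI, elim conjE)
    fix K :: "nat \<Rightarrow> (real \<times> real) set" and \<alpha> \<beta> :: real
    assume fam: "convex_family N K"
      and "\<forall>i<N. \<exists>p\<in>K i. fst p = \<alpha>" "\<forall>i<N. \<exists>p\<in>K i. fst p = \<beta>"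
      and pairs: "\<forall>i<N. \<forall>j<N. i \<noteq> j \<longrightarrow> (\<exists>p\<in>K i \<inter> K j. \<alpha> \<le> fst p \<and> fst p \<le> \<beta>)"
    then obtain a h where a: "\<And>i. i < N \<Longrightarrow> a i \<in> K i" "\<And>i. i < N \<Longrightarrow> fst (a i) = \<alpha>"
      and h: "\<And>i. i < N \<Longrightarrow> h i \<in> K i" "\<And>i. i < N \<Longrightarrow> fst (h i) = \<beta>"
      by metis
    have "\<exists>p. p \<in> K i \<inter> K j \<and> \<alpha> \<le> fst p \<and> fst p \<le> \<beta>" if "i < N" "j < N" "i \<noteq> j" for i j
      using pairs that by blast
    then obtain q where q: "\<And>i j. i < N \<Longrightarrow> j < N \<Longrightarrow> i \<noteq> j \<Longrightarrow> q i j \<in> K i \<inter> K j \<and> \<alpha> \<le> fst (q i j) \<and> fst (q i j) \<le> \<beta>"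
      by metis
    obtain s where s: "bij_betw s {..<N} {..<N}"
      and sorted: "\<And>i j. i < j \<Longrightarrow> j < N \<Longrightarrow> snd (h (s i)) \<le> snd (h (s j))"
      using ex_sorting_bij[of N "\<lambda>i. snd (h i)"] by blast
    obtain t b where t: "increasing_into m N t" and
      hom: "\<forall>i j. i < j \<and> j < m \<longrightarrow> (snd (a (s (t i))) \<le> snd (a (s (t j)))) = b"
      using spec[OF N, of "\<lambda>i j. snd (a (s i)) \<le> snd (a (s j))"] by blast
    define g where "g i = s (t i)" for i
    have gN: "\<forall>i<m. g i < N"
      unfolding g_def using bij_betwE[OF s] increasing_intoD(1)[OF t] by auto
    have g_inj: "inj_on g {..<m}"
      unfolding g_def
      by (rule inj_on_lessThan_compose[OF bij_betw_imp_inj_on[OF s] increasing_intoD(3,1)[OF t]])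
    have g_sorted: "snd (h (g i)) \<le> snd (h (g j))" if "i < j" "j < m" for i j
      unfolding g_def using sorted[of "t i" "t j"] increasing_intoD(1,2)[OF t] that by auto
    have neq: "g i \<noteq> g j" if "i < j" "j < m" for i j
      using inj_onD[OF g_inj, of i j] that by auto
    have "\<alpha> \<le> \<beta>"
      using q[of "g 0" "g 1"] neq[of 0 1] gN by (fastforce simp: m_def)
    have "has_crossing_segments n m (\<lambda>i. K (g i))"
    proof (cases b)
      case True
      have "layered_slab m0 (\<lambda>i. K (g i)) \<alpha> \<beta> (\<lambda>i. a (g i)) (\<lambda>i. h (g i)) (\<lambda>i j. q (g i) (g j))"
        using convex_family_reindex[OF fam, of g m0] inj_on_subset[OF g_inj, of "{..<m0}"] a h q gN g_sorted hom neq True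
        unfolding layered_slab_def g_def[symmetric] m_def by auto
      then have "has_crossing_segments n m0 (\<lambda>i. K (g i))"
        using m0 by blast
      then show ?thesis
        using has_crossing_segments_reindex[of n m0 "\<lambda>i. K (g i)" "\<lambda>i. i" m] by (auto simp: m_def)
    next
      case False
      have "\<exists>z. z \<in> closed_segment (a (g i)) (h (g i)) \<and> z \<in> closed_segment (a (g j)) (h (g j))"
        if "i < j" "j < m" for i j
      proof (rule segments_cross[of "a (g j)" "a (g i)" "h (g j)" "h (g i)"])
        show "snd (a (g j)) \<le> snd (a (g i))"
          using hom[rule_format, of i j] that False by (simp add: g_def)
        show "snd (h (g i)) \<le> snd (h (g j))"
          using g_sorted that by simp
      qed (use a h gN that \<open>\<alpha> \<le> \<beta>\<close> in auto)
      then show ?thesis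
        by (intro has_crossing_segmentsI[of "{..<n}" _ _ "\<lambda>i. a (g i)" _ "\<lambda>i. h (g i)"])
           (use a h gN in \<open>auto simp: m_def\<close>)
    qed
    then show "has_crossing_segments n N K"
      by (rule has_crossing_segments_reindex[OF _ g_inj gN])
  qed
qed

section \<open>Crossing segments in arbitrary planar families\<close>

text \<open>\<open>cut_left\<close> is applied twice, first to the family and then to the mirror
  image of its part to the right of the cut. What remains satisfies the hypotheses of
  \<open>crossing_segments_slab\<close>; the bounds are chosen in the opposite order.\<close>

lemma crossing_segments_compact:
  fixes n :: nat
  shows "\<exists>N. \<forall>K. (\<forall>i<N. compact (K i)) \<and> convex_family N K \<longrightarrow> has_crossing_segments n N K"
proof -
  obtain N3 where N3: "\<forall>K \<alpha> \<beta>. convex_family N3 K \<and> (\<forall>i<N3. \<exists>p\<in>K i. fst p = \<alpha>) \<and> (\<forall>i<N3. \<exists>p\<in>K i. fst p = \<beta>) \<and>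
     (\<forall>i<N3. \<forall>j<N3. i \<noteq> j \<longrightarrow> (\<exists>p\<in>K i \<inter> K j. \<alpha> \<le> fst p \<and> fst p \<le> \<beta>)) \<longrightarrow> has_crossing_segments n N3 K"
    by (rule exE[OF crossing_segments_slab])
  obtain N2 where N2: "\<forall>K. (\<forall>i<N2. compact (K i)) \<and> convex_family N2 K \<longrightarrow> has_crossing_segments n N2 K \<or>
     (\<exists>f \<alpha>. inj_on f {..<N3} \<and> (\<forall>i<N3. f i < N2) \<and> (\<forall>i<N3. \<exists>p\<in>K (f i). fst p = \<alpha>) \<and>
        (\<forall>i<N3. \<forall>j<N3. i \<noteq> j \<longrightarrow> (\<exists>p\<in>K (f i) \<inter> K (f j). \<alpha> \<le> fst p)))"
    by (rule exE[OF cut_left])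
  obtain N1 where N1: "\<forall>K. (\<forall>i<N1. compact (K i)) \<and> convex_family N1 K \<longrightarrow> has_crossing_segments n N1 K \<or>
     (\<exists>f \<alpha>. inj_on f {..<N2} \<and> (\<forall>i<N2. f i < N1) \<and> (\<forall>i<N2. \<exists>p\<in>K (f i). fst p = \<alpha>) \<and>
        (\<forall>i<N2. \<forall>j<N2. i \<noteq> j \<longrightarrow> (\<exists>p\<in>K (f i) \<inter> K (f j). \<alpha> \<le> fst p)))"
    by (rule exE[OF cut_left])
  show ?thesis
  proof (intro exI[of _ N1] allI impI)
    fix K assume K: "(\<forall>i<N1. compact (K i)) \<and> convex_family N1 K"
    show "has_crossing_segments n N1 K"
    proof (rule ccontr)
      \<comment> \<open>Without crossing segments in \<open>K\<close> there are none in subfamilies,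
        in smaller sets or in mirror images, so both cuts succeed.\<close>
      assume no: "\<not> has_crossing_segments n N1 K"
      obtain f \<alpha> where f: "inj_on f {..<N2}" "\<forall>i<N2. f i < N1"
        and meet_\<alpha>: "\<forall>i<N2. \<exists>p\<in>K (f i). fst p = \<alpha>"
        and right: "\<forall>i<N2. \<forall>j<N2. i \<noteq> j \<longrightarrow> (\<exists>p\<in>K (f i) \<inter> K (f j). \<alpha> \<le> fst p)"
        using mp[OF spec[OF N1, of K] K] no by (elim disjE exE conjE) (blast, rule that)
      \<comment> \<open>Restricting the sets to the half-plane preserves pairwise intersection,
        because all selected pairs have a common point there.\<close>
      define H where "H i = K (f i) \<inter> {p. \<alpha> \<le> fst p}" for i
      have closed: "closed {p::real \<times> real. \<alpha> \<le> fst p}"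
        by (intro closed_Collect_le continuous_intros)
      have "linear (fst :: real \<times> real \<Rightarrow> real)"
        by (simp add: linear_fst)
      then have "convex {p::real \<times> real. \<alpha> \<le> fst p}"
        using convex_linear_vimage[of fst "{\<alpha>..}"] by (simp add: vimage_def)
      moreover have famf: "convex_family N2 (\<lambda>i. K (f i))"
        by (rule convex_family_reindex[OF conjunct2[OF K] f])
      ultimately have "\<forall>i<N2. convex (H i)"
        using convex_family_convex[OF famf] by (simp add: H_def convex_Int)
      moreover have "H i \<inter> H j \<noteq> {}" if ij: "i < N2" "j < N2" "i \<noteq> j" for i j
      proof -
        obtain p where "p \<in> K (f i) \<inter> K (f j)" "\<alpha> \<le> fst p"
          using right ij by blast
        then show ?thesis
          by (auto simp: H_def)
      qed
      moreover have "H i \<inter> H j \<inter> H k = {}" if "i < N2" "j < N2" "k < N2" "i \<noteq> j" "i \<noteq> k" "j \<noteq> k" for i j k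
        using convex_family_no_triple[OF famf that] by (auto simp: H_def)
      ultimately have famH: "convex_family N2 H"
        by (simp add: convex_family_def strictly_2_intersecting_def)
      have compactH: "\<forall>i<N2. compact (H i)"
        using K f(2) closed by (auto simp: H_def intro!: compact_Int_closed)
      have noH: "\<not> has_crossing_segments n N2 H"
      proof
        assume "has_crossing_segments n N2 H"
        then have "has_crossing_segments n N2 (\<lambda>i. K (f i))"
          by (rule has_crossing_segments_mono) (auto simp: H_def)
        then show False
          using has_crossing_segments_reindex[OF _ f] no by blast
      qed
      have no_reflect: "\<not> has_crossing_segments n N2 (\<lambda>i. reflect_fst ` H i)"
        using noH has_crossing_segments_linear_image[of n N2 reflect_fst H] by auto
      have fam_reflect: "convex_family N2 (\<lambda>i. reflect_fst ` H i)"
        using convex_family_linear_image[OF famH] by simp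
      have compact_reflect: "\<forall>i<N2. compact (reflect_fst ` H i)"
        using compactH by (auto intro!: compact_continuous_image linear_continuous_on simp: linear_conv_bounded_linear[symmetric])
      obtain g \<gamma> where g: "inj_on g {..<N3}" "\<forall>i<N3. g i < N2"
        and meet_\<gamma>: "\<forall>i<N3. \<exists>p\<in>reflect_fst ` H (g i). fst p = \<gamma>"
        and left: "\<forall>i<N3. \<forall>j<N3. i \<noteq> j \<longrightarrow> (\<exists>p\<in>reflect_fst ` H (g i) \<inter> reflect_fst ` H (g j). \<gamma> \<le> fst p)"
        using mp[OF spec[OF N2] conjI[OF compact_reflect fam_reflect]] no_reflect
        by (elim disjE exE conjE) (blast, rule that)
      \<comment> \<open>The half-plane contains its boundary line, so the points at
        \<open>\<alpha>\<close> survive. The second cut was made in the mirror image, so its line is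
        at \<open>- \<gamma>\<close>.\<close>
      have "\<exists>p\<in>H (g i). fst p = \<alpha>" if "i < N3" for i
        using meet_\<alpha> g(2) that by (fastforce simp: H_def)
      moreover have "\<exists>p\<in>H (g i). fst p = - \<gamma>" if "i < N3" for i
        using meet_\<gamma> that by (metis image_iff reflect_fst(3) add.inverse_inverse)
      moreover have "\<exists>p\<in>H (g i) \<inter> H (g j). \<alpha> \<le> fst p \<and> fst p \<le> - \<gamma>" if ij: "i < N3" "j < N3" "i \<noteq> j" for i j
      proof -
        obtain p where "p \<in> reflect_fst ` H (g i)" "p \<in> reflect_fst ` H (g j)" "\<gamma> \<le> fst p"
          using left ij by blast
        then show ?thesis
          by (intro bexI[of _ "reflect_fst p"]) (auto simp: H_def)
      qed
      moreover have "convex_family N3 (\<lambda>i. H (g i))"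
        by (rule convex_family_reindex[OF famH g])
      ultimately have "has_crossing_segments n N3 (\<lambda>i. H (g i))"
        using spec[OF spec[OF spec[OF N3, of "\<lambda>i. H (g i)"], of \<alpha>], of "- \<gamma>"] by blast
      then show False
        using has_crossing_segments_reindex[OF _ g] noH by blast
    qed
  qed
qed

text \<open>Compactness is obtained by shrinking: each set is replaced by the convex hull of
  finitely many chosen points that it shares with the other sets.\<close>

theorem crossing_segments:
  fixes n :: nat
  shows "\<exists>N. \<forall>K. convex_family N K \<longrightarrow> has_crossing_segments n N K"
proof -
  obtain N where N: "\<forall>K. (\<forall>i<N. compact (K i)) \<and> convex_family N K \<longrightarrow> has_crossing_segments n N K"
    by (rule exE[OF crossing_segments_compact])
  show ?thesis
  proof (intro exI[of _ N] allI impI)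
    fix K assume fam: "convex_family N K"
    have "\<exists>p. p \<in> K i \<and> p \<in> K j" if "i < N" "j < N" "i \<noteq> j" for i j
      using convex_family_meet[OF fam that] by blast
    then obtain q where q: "\<And>i j. i < N \<Longrightarrow> j < N \<Longrightarrow> i \<noteq> j \<Longrightarrow> q i j \<in> K i \<and> q i j \<in> K j"
      by metis
    \<comment> \<open>The choice \<open>q\<close> need not be symmetric. Including both
      \<open>q i j\<close> and \<open>q j i\<close> puts each of these points into both
      hulls.\<close>
    define Q where "Q i = {q i j |j. j < N \<and> i \<noteq> j} \<union> {q j i |j. j < N \<and> i \<noteq> j}" for i
    define H where "H i = convex hull (Q i)" for i
    have sub: "H i \<subseteq> K i" if "i < N" for i
      unfolding H_def using q that convex_family_convex[OF fam that]
      by (intro hull_minimal) (auto simp: Q_def)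
    have "H i \<inter> H j \<noteq> {}" if "i < N" "j < N" "i \<noteq> j" for i j
    proof -
      have "q i j \<in> Q i" "q i j \<in> Q j"
        using that by (auto simp: Q_def)
      then show ?thesis
        unfolding H_def using hull_inc[of "q i j"] by blast
    qed
    moreover have "H i \<inter> H j \<inter> H k = {}" if "i < N" "j < N" "k < N" "i \<noteq> j" "i \<noteq> k" "j \<noteq> k" for i j k
      using convex_family_no_triple[OF fam that] sub that by blast
    moreover have "convex (H i)" for i
      by (simp add: H_def)
    ultimately have "convex_family N H"
      unfolding convex_family_def strictly_2_intersecting_def by simp
    moreover have "compact (H i)" for i
      unfolding H_def Q_def by (intro finite_imp_compact_convex_hull) simp
    ultimately have "has_crossing_segments n N H"
      using N by blast
    then show "has_crossing_segments n N K"
      by (rule has_crossing_segments_mono) (rule sub)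
  qed
qed

section \<open>Removing vertical segments and separating slopes\<close>

text \<open>One of the points lies between the other two, and these two share the set not yet known
  to contain the middle point. By convexity the middle point then lies in all three sets.\<close>

lemma no_collinear_crossings:
  assumes fam: "convex_family N K" and ijk: "i < N" "j < N" "k < N" "i \<noteq> j" "i \<noteq> k" "j \<noteq> k"
    and mem: "p \<in> K i" "p \<in> K j" "q \<in> K i" "q \<in> K k" "r \<in> K j" "r \<in> K k"
    and col: "collinear {p, q, r}"
  shows False
proof -
  have sub: "x \<in> K l" if "between (y, z) x" "y \<in> K l" "z \<in> K l" "l < N" for x y z l
    using that closed_segment_subset[of y "K l" z] convex_family_convex[OF fam, of l]
    by (auto simp: between_mem_segment)
  consider "between (q, r) p" | "between (r, p) q" | "between (p, q) r"
    using col by (auto simp: collinear_between_cases)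
  then have "p \<in> K k \<or> q \<in> K j \<or> r \<in> K i"
    using sub mem ijk by cases blast+
  then show False
    using convex_family_no_triple[OF fam ijk] mem by blast
qed

text \<open>Two segments that meet and have the same direction lie on one line, and so do their
  crossings with a third segment, contrary to \<open>no_collinear_crossings\<close>. Hence at most
  one segment is vertical, and the slopes of the others differ.\<close>

lemma nonvertical_crossing_segments:
  fixes n :: nat
  shows "\<exists>N. \<forall>K. convex_family N K \<longrightarrow> (\<exists>J c d. J \<subseteq> {..<N} \<and> card J = n \<and>
     (\<forall>i\<in>J. c i \<in> K i \<and> d i \<in> K i \<and> fst (c i) \<noteq> fst (d i)) \<and>
     (\<forall>i\<in>J. \<forall>j\<in>J. i \<noteq> j \<longrightarrow> closed_segment (c i) (d i) \<inter> closed_segment (c j) (d j) \<noteq> {} \<and>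
        (snd (d i) - snd (c i)) / (fst (d i) - fst (c i)) \<noteq> (snd (d j) - snd (c j)) / (fst (d j) - fst (c j))))"
proof -
  \<comment> \<open>Of \<open>n + 3\<close> segments at most one is dropped as vertical, and besides
    any two there is always a third.\<close>
  obtain N where N: "\<forall>K. convex_family N K \<longrightarrow> has_crossing_segments (n + 3) N K"
    by (rule exE[OF crossing_segments])
  show ?thesis
  proof (intro exI[of _ N] allI impI)
    fix K assume fam: "convex_family N K"
    obtain I c d where I: "I \<subseteq> {..<N}" "card I = n + 3"
      and cd: "\<forall>i\<in>I. c i \<in> K i \<and> d i \<in> K i"
      and meet: "\<forall>i\<in>I. \<forall>j\<in>I. i \<noteq> j \<longrightarrow> closed_segment (c i) (d i) \<inter> closed_segment (c j) (d j) \<noteq> {}"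
      using mp[OF spec[OF N] fam] unfolding has_crossing_segments_def by (elim exE conjE) (rule that)
    have finI: "finite I"
      using I(1) finite_subset by blast
    have segK: "closed_segment (c i) (d i) \<subseteq> K i" if "i \<in> I" for i
      using that cd I(1) convex_family_convex[OF fam] by (intro closed_segment_subset) auto
    \<comment> \<open>A normal vector \<open>a\<close> treats all directions alike: it will be
      \<open>(1, 0)\<close> for vertical segments and \<open>(m, - 1)\<close> for slope
      \<open>m\<close>.\<close>
    have no_common_line: False
      if ij: "i \<in> I" "j \<in> I" "i \<noteq> j" and a: "a \<noteq> 0"
        and eqs: "a \<bullet> c i = r" "a \<bullet> d i = r" "a \<bullet> c j = s" "a \<bullet> d j = s" for i j r s and a :: "real \<times> real"
    proof -
      have "card (I - {i, j}) \<noteq> 0"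
        using I(2) card_Diff_subset[of "{i, j}" I] ij by simp
      then obtain k where k: "k \<in> I" "i \<noteq> k" "j \<noteq> k"
        by (metis DiffE all_not_in_conv card.empty insertCI)
      have "closed_segment (c i) (d i) \<inter> closed_segment (c j) (d j) \<noteq> {}"
        "closed_segment (c i) (d i) \<inter> closed_segment (c k) (d k) \<noteq> {}"
        "closed_segment (c j) (d j) \<inter> closed_segment (c k) (d k) \<noteq> {}"
        using meet ij k by simp_all
      then obtain p q t where p: "p \<in> closed_segment (c i) (d i)" "p \<in> closed_segment (c j) (d j)"
        and q: "q \<in> closed_segment (c i) (d i)" "q \<in> closed_segment (c k) (d k)"
        and t: "t \<in> closed_segment (c j) (d j)" "t \<in> closed_segment (c k) (d k)"
        unfolding ex_in_conv[symmetric] by (elim exE IntE) (rule that)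
      have on_i: "closed_segment (c i) (d i) \<subseteq> {x. a \<bullet> x = r}"
        using eqs by (intro closed_segment_subset convex_hyperplane) auto
      have on_j: "closed_segment (c j) (d j) \<subseteq> {x. a \<bullet> x = s}"
        using eqs by (intro closed_segment_subset convex_hyperplane) auto
      have "r = s"
        using on_i on_j p by auto
      then have "{p, q, t} \<subseteq> {x. a \<bullet> x = r}"
        using on_i on_j p q t by auto
      moreover have "collinear {x. a \<bullet> x = r}"
        using a by (simp add: collinear_aff_dim aff_dim_hyperplane)
      ultimately have "collinear {p, q, t}"
        using collinear_subset by blast
      moreover have "p \<in> K i" "p \<in> K j" "q \<in> K i" "q \<in> K k" "t \<in> K j" "t \<in> K k"
        using p q t segK ij k by auto
      ultimately show False
        using no_collinear_crossings[OF fam, of i j k p q t] I(1) ij k by auto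
    qed
    \<comment> \<open>\<open>V\<close> also contains the degenerate segments, whose endpoints
      coincide.\<close>
    define V where "V = {i \<in> I. fst (c i) = fst (d i)}"
    have "i = j" if "i \<in> V" "j \<in> V" for i j
      using no_common_line[of i j "(1, 0)" "fst (c i)" "fst (c j)"] that
      by (auto simp: V_def inner_prod_def zero_prod_def)
    then have "card V \<le> 1"
      using finI by (metis V_def card_le_Suc0_iff_eq finite_Collect_conjI finite_subset mem_Collect_eq One_nat_def subsetI)
    then have "n \<le> card (I - V)"
      using I(2) diff_card_le_card_Diff[of V I] finI by (simp add: V_def)
    then obtain J where J: "J \<subseteq> I - V" "card J = n"
      by (meson obtain_subset_with_card_n)
    have slopes: "(snd (d i) - snd (c i)) / (fst (d i) - fst (c i)) \<noteq> (snd (d j) - snd (c j)) / (fst (d j) - fst (c j))"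
      if "i \<in> J" "j \<in> J" "i \<noteq> j" for i j
    proof
      let ?m = "\<lambda>i. (snd (d i) - snd (c i)) / (fst (d i) - fst (c i))"
      assume eq: "?m i = ?m j"
      have *: "?m i * fst (d i) - snd (d i) = ?m i * fst (c i) - snd (c i)" if "i \<in> J" for i
      proof -
        have "?m i * (fst (d i) - fst (c i)) = snd (d i) - snd (c i)"
          using that J(1) by (auto simp: V_def)
        then show ?thesis
          by (simp only: right_diff_distrib)
      qed
      have "i \<in> I" "j \<in> I" "(?m i, - 1 :: real) \<noteq> 0"
        using that J(1) by (auto simp: zero_prod_def)
      then show False
        using no_common_line[of i j "(?m i, - 1)" "?m i * fst (c i) - snd (c i)" "?m j * fst (c j) - snd (c j)"]
          *[OF that(1)] *[OF that(2)] that(3) eq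
        by (simp add: inner_prod_def)
    qed
    have "J \<subseteq> {..<N}" "\<forall>i\<in>J. c i \<in> K i \<and> d i \<in> K i \<and> fst (c i) \<noteq> fst (d i)"
      "\<forall>i\<in>J. \<forall>j\<in>J. i \<noteq> j \<longrightarrow> closed_segment (c i) (d i) \<inter> closed_segment (c j) (d j) \<noteq> {}"
      subgoal using J(1) I(1) by auto
      subgoal using J(1) cd by (auto simp: V_def)
      subgoal using J(1) meet by (meson DiffD1 subsetD)
      done
    then show "\<exists>J c d. J \<subseteq> {..<N} \<and> card J = n \<and>
     (\<forall>i\<in>J. c i \<in> K i \<and> d i \<in> K i \<and> fst (c i) \<noteq> fst (d i)) \<and>
     (\<forall>i\<in>J. \<forall>j\<in>J. i \<noteq> j \<longrightarrow> closed_segment (c i) (d i) \<inter> closed_segment (c j) (d j) \<noteq> {} \<and>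
        (snd (d i) - snd (c i)) / (fst (d i) - fst (c i)) \<noteq> (snd (d j) - snd (c j)) / (fst (d j) - fst (c j)))"
      using J(2) slopes by (intro exI[of _ J] exI[of _ c] exI[of _ d]) simp
  qed
qed

subsection \<open>Graphs of affine functions as lines\<close>

definition line2 :: "real \<Rightarrow> real \<Rightarrow> (real^2) set" where
  "line2 m b = {q. q $ 2 = m * q $ 1 + b}"

text \<open>The first coordinate is the parameter, so the projection is a \<open>line2\<close>,
  which is not vertical in the plane. Such lines suffice once vertical planar segments have been
  discarded.\<close>

definition line3 :: "real \<Rightarrow> real \<Rightarrow> real \<Rightarrow> real \<Rightarrow> (real^3) set" where
  "line3 m b u v = {p. p $ 2 = m * p $ 1 + b \<and> p $ 3 = u * p $ 1 + v}"

lemma proj_nth [simp]: "proj p $ 1 = p $ 1" "proj p $ 2 = p $ 2"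
  by (simp_all add: proj_def)

lemma proj_line3: "proj ` line3 m b u v = line2 m b"
proof
  show "line2 m b \<subseteq> proj ` line3 m b u v"
  proof
    fix q assume "q \<in> line2 m b"
    then show "q \<in> proj ` line3 m b u v"
      by (intro image_eqI[of _ _ "vector [q $ 1, q $ 2, u * q $ 1 + v]"])
         (auto simp: line2_def line3_def vec_eq_iff forall_2)
  qed
qed (auto simp: line2_def line3_def)

lemma line2_affine_hull: "line2 m b = affine hull {vector [0, b], vector [1, m + b]}"
proof -
  have "q = vector [0, b] + (q $ 1) *\<^sub>R (vector [1, m + b] - vector [0, b])" if "q \<in> line2 m b" for q
    using that by (auto simp: line2_def vec_eq_iff forall_2 algebra_simps)
  moreover have "vector [0, b] + t *\<^sub>R (vector [1, m + b] - vector [0, b]) \<in> line2 m b" for t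
    by (simp add: line2_def algebra_simps)
  ultimately show ?thesis
    unfolding affine_hull_2_alt by blast
qed

lemma line3_affine_hull:
  "line3 m b u v = affine hull {vector [0, b, v], vector [1, m + b, u + v]}"
proof -
  have "p = vector [0, b, v] + (p $ 1) *\<^sub>R (vector [1, m + b, u + v] - vector [0, b, v])"
    if "p \<in> line3 m b u v" for p
    using that by (auto simp: line3_def vec_eq_iff forall_3 algebra_simps)
  moreover have "vector [0, b, v] + t *\<^sub>R (vector [1, m + b, u + v] - vector [0, b, v]) \<in> line3 m b u v" for t
    by (simp add: line3_def algebra_simps)
  ultimately show ?thesis
    unfolding affine_hull_2_alt by blast
qed

lemma nonvertical_line2_line2: "nonvertical_line2 (line2 m b)"
proof -
  have "(vector [0, b] :: real^2) \<noteq> vector [1, m + b]"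
    by (simp add: vec_eq_iff forall_2)
  then have "is_line (line2 m b)"
    by (simp add: is_line_def line2_affine_hull aff_dim_affine_hull)
  moreover have "\<not> vertical_line2 (line2 m b)"
  proof
    assume "vertical_line2 (line2 m b)"
    then obtain a where a: "line2 m b = {q. q $ 1 = a}"
      by (auto simp: vertical_line2_def)
    have "vector [0, b] \<in> line2 m b" "vector [1, m + b] \<in> line2 m b"
      by (auto simp: line2_def)
    then show False
      unfolding a by simp
  qed
  ultimately show ?thesis
    by (simp add: nonvertical_line2_def)
qed

lemma nonvertical_line3_line3: "nonvertical_line3 (line3 m b u v)"
proof -
  have "(vector [0, b, v] :: real^3) \<noteq> vector [1, m + b, u + v]"
    by (simp add: vec_eq_iff forall_3)
  then have "is_line (line3 m b u v)"
    by (simp add: is_line_def line3_affine_hull aff_dim_affine_hull)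
  moreover have "\<not> vertical_line3 (line3 m b u v)"
  proof
    assume "vertical_line3 (line3 m b u v)"
    then obtain a c where a: "line3 m b u v = {q. q $ 1 = a \<and> q $ 2 = c}"
      by (auto simp: vertical_line3_def)
    have "vector [0, b, v] \<in> line3 m b u v" "vector [1, m + b, u + v] \<in> line3 m b u v"
      by (auto simp: line3_def)
    then show False
      unfolding a by simp
  qed
  ultimately show ?thesis
    by (simp add: nonvertical_line3_def)
qed

lemma line2_eq_iff: "line2 m b = line2 m' b' \<longleftrightarrow> m = m' \<and> b = b'"
proof
  assume eq: "line2 m b = line2 m' b'"
  have "vector [0, b] \<in> line2 m b" "vector [1, m + b] \<in> line2 m b"
    by (auto simp: line2_def)
  then show "m = m' \<and> b = b'"
    unfolding eq by (auto simp: line2_def)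
qed simp

lemma slope_line2: "slope (line2 m b) = m"
  unfolding slope_def
proof (rule the_equality)
  show "\<exists>c. line2 m b = {q. q $ 2 = m * q $ 1 + c}"
    by (auto simp: line2_def)
  fix m' assume "\<exists>c. line2 m b = {q. q $ 2 = m' * q $ 1 + c}"
  then show "m' = m"
    using line2_eq_iff[of m b m'] unfolding line2_def[of m'] by auto
qed

text \<open>A translation preserves the increment of the second coordinate between points whose
  abscissae differ by 1.\<close>

lemma not_affine_parallel_line2:
  assumes "m \<noteq> m'"
  shows "\<not> affine_parallel (line2 m b) (line2 m' b')"
proof
  assume "affine_parallel (line2 m b) (line2 m' b')"
  then obtain a where a: "line2 m' b' = (\<lambda>x. a + x) ` line2 m b"
    by (auto simp: affine_parallel_def)
  have "a + vector [0, b] \<in> line2 m' b'" "a + vector [1, m + b] \<in> line2 m' b'"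
    unfolding a by (auto simp: line2_def)
  then show False
    using assms by (auto simp: line2_def algebra_simps)
qed

lemma lines_meet_iff:
  fixes m m' b b' x :: real
  assumes "m \<noteq> m'"
  shows "m * x + b = m' * x + b' \<longleftrightarrow> x = (b' - b) / (m - m')"
  using assms by (auto simp: field_simps)

lemma line2_Int:
  assumes "m \<noteq> m'"
  shows "line2 m b \<inter> line2 m' b' = {vector [(b' - b) / (m - m'), m * ((b' - b) / (m - m')) + b]}"
proof -
  have eq: "q \<in> line2 m b \<inter> line2 m' b' \<longleftrightarrow> q $ 1 = (b' - b) / (m - m') \<and> q $ 2 = m * q $ 1 + b" for q
    using lines_meet_iff[OF assms, of "q $ 1" b b'] by (auto simp: line2_def)
  show ?thesis
    by (rule set_eqI, unfold eq) (auto simp: vec_eq_iff forall_2)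
qed

text \<open>A vertical line meeting both lines stands over the crossing of their projections, which
  is unique as the slopes differ. This resolves both definite descriptions.\<close>

lemma crossing_point_line3:
  assumes "m \<noteq> m'" and x: "m * x + b = m' * x + b'"
  shows "crossing_point (line3 m b u v) (line3 m' b' u' v') = vector [x, m * x + b, u * x + v]"
proof -
  have "common_vertical (line3 m b u v) (line3 m' b' u' v') = {p. p $ 1 = x \<and> p $ 2 = m * x + b}"
    unfolding common_vertical_def
  proof (rule the_equality)
    let ?V = "{p::real^3. p $ 1 = x \<and> p $ 2 = m * x + b}"
    have "vector [x, m * x + b, u * x + v] \<in> ?V \<inter> line3 m b u v"
      "vector [x, m' * x + b', u' * x + v'] \<in> ?V \<inter> line3 m' b' u' v'"
      using x by (auto simp: line3_def)
    then have "?V \<inter> line3 m b u v \<noteq> {}" "?V \<inter> line3 m' b' u' v' \<noteq> {}"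
      by blast+
    then show "vertical_line3 ?V \<and> ?V \<inter> line3 m b u v \<noteq> {} \<and> ?V \<inter> line3 m' b' u' v' \<noteq> {}"
      by (auto simp: vertical_line3_def)
  next
    fix V assume V: "vertical_line3 V \<and> V \<inter> line3 m b u v \<noteq> {} \<and> V \<inter> line3 m' b' u' v' \<noteq> {}"
    then obtain s t where st: "V = {p. p $ 1 = s \<and> p $ 2 = t}"
      by (auto simp: vertical_line3_def)
    then have "t = m * s + b" "t = m' * s + b'"
      using V by (auto simp: line3_def)
    then have "s = x"
      using lines_meet_iff[OF assms(1), of s b b'] lines_meet_iff[OF assms(1), of x b b'] x by simp
    then show "V = {p. p $ 1 = x \<and> p $ 2 = m * x + b}"
      using st \<open>t = m * s + b\<close> by simp
  qed
  then show ?thesis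
    unfolding crossing_point_def
    by (intro the_equality) (auto simp: line3_def vec_eq_iff forall_3)
qed

text \<open>On the common vertical line the two heights are comparable, and equal heights mean that
  the lines meet. By this totality it suffices to colour pairs by
  \<open>line_below_eq\<close>.\<close>

lemma line_below_eq_or_above_eq:
  assumes "m \<noteq> m'"
  shows "line_below_eq (line3 m b u v) (line3 m' b' u' v') \<or> line_above_eq (line3 m b u v) (line3 m' b' u' v')"
proof -
  define x where "x = (b' - b) / (m - m')"
  have x: "m * x + b = m' * x + b'"
    unfolding lines_meet_iff[OF assms] by (rule x_def)
  have 1: "crossing_point (line3 m b u v) (line3 m' b' u' v') $ 3 = u * x + v"
    using crossing_point_line3[OF assms x] by simp
  have 2: "crossing_point (line3 m' b' u' v') (line3 m b u v) $ 3 = u' * x + v'"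
    using crossing_point_line3[OF assms[symmetric] x[symmetric]] by simp
  show ?thesis
  proof (cases "u * x + v = u' * x + v'")
    case True
    then have "vector [x, m * x + b, u * x + v] \<in> line3 m b u v \<inter> line3 m' b' u' v'"
      using x by (simp add: line3_def)
    then show ?thesis
      by (auto simp: line_below_eq_def)
  next
    case False
    then show ?thesis
      by (auto simp: line_below_eq_def line_above_eq_def line_below_def line_above_def 1 2)
  qed
qed

subsection \<open>Lifting to space\<close>

text \<open>This is \<open>proj\<close> with values in the type of the planar argument;
  \<open>proj_pair_eq_iff\<close> carries common points from one version to the other.\<close>

definition proj_pair :: "real^3 \<Rightarrow> real \<times> real" where
  "proj_pair p = (p $ 1, p $ 2)"

lemma linear_proj_pair: "linear proj_pair"
  by (simp add: linear_iff proj_pair_def)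

lemma proj_pair_eq_iff: "proj_pair p = proj_pair p' \<longleftrightarrow> proj p = proj p'"
  by (simp add: proj_pair_def vec_eq_iff forall_2)

lemma pairwise_crossing_lines:
  fixes n :: nat
  shows "\<exists>N. \<forall>K. (\<forall>i<N. convex (K i)) \<and> convex_family N (\<lambda>i. proj_pair ` K i) \<longrightarrow>
     (\<exists>J m b u v. J \<subseteq> {..<N} \<and> card J = n \<and> (\<forall>i\<in>J. \<forall>j\<in>J. i \<noteq> j \<longrightarrow> m i \<noteq> m j \<and>
        proj ` (K i \<inter> line3 (m i) (b i) (u i) (v i)) \<inter> proj ` (K j \<inter> line3 (m j) (b j) (u j) (v j)) \<noteq> {}))"
proof -
  obtain N where N: "\<forall>K. convex_family N K \<longrightarrow> (\<exists>J c d. J \<subseteq> {..<N} \<and> card J = n \<and>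
     (\<forall>i\<in>J. c i \<in> K i \<and> d i \<in> K i \<and> fst (c i) \<noteq> fst (d i)) \<and>
     (\<forall>i\<in>J. \<forall>j\<in>J. i \<noteq> j \<longrightarrow> closed_segment (c i) (d i) \<inter> closed_segment (c j) (d j) \<noteq> {} \<and>
        (snd (d i) - snd (c i)) / (fst (d i) - fst (c i)) \<noteq> (snd (d j) - snd (c j)) / (fst (d j) - fst (c j))))"
    by (rule exE[OF nonvertical_crossing_segments])
  show ?thesis
  proof (intro exI[of _ N] allI impI, elim conjE)
    fix K assume convex: "\<forall>i<N. convex (K i)" and fam: "convex_family N (\<lambda>i. proj_pair ` K i)"
    obtain J c d where J: "J \<subseteq> {..<N}" "card J = n"
      and cd: "\<forall>i\<in>J. c i \<in> proj_pair ` K i \<and> d i \<in> proj_pair ` K i \<and> fst (c i) \<noteq> fst (d i)"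
      and meet: "\<forall>i\<in>J. \<forall>j\<in>J. i \<noteq> j \<longrightarrow> closed_segment (c i) (d i) \<inter> closed_segment (c j) (d j) \<noteq> {} \<and>
        (snd (d i) - snd (c i)) / (fst (d i) - fst (c i)) \<noteq> (snd (d j) - snd (c j)) / (fst (d j) - fst (c j))"
      using mp[OF spec[OF N] fam] by (elim exE conjE) (rule that)
    have "\<forall>i\<in>J. \<exists>p. p \<in> K i \<and> c i = proj_pair p" "\<forall>i\<in>J. \<exists>p. p \<in> K i \<and> d i = proj_pair p"
      using cd by auto
    from bchoice[OF this(1)] bchoice[OF this(2)]
    obtain C D where C: "\<forall>i\<in>J. C i \<in> K i \<and> c i = proj_pair (C i)"
      and D: "\<forall>i\<in>J. D i \<in> K i \<and> d i = proj_pair (D i)"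
      by (elim exE) (rule that)
    \<comment> \<open>The line through \<open>C i\<close> and \<open>D i\<close> is written over the
      first coordinate: \<open>m\<close> and \<open>b\<close> give the second coordinate,
      \<open>u\<close> and \<open>v\<close> the third. The endpoints have different abscissae, so
      the denominators do not vanish.\<close>
    define m where "m i = (snd (d i) - snd (c i)) / (fst (d i) - fst (c i))" for i
    define b where "b i = snd (c i) - m i * fst (c i)" for i
    define u where "u i = (D i $ 3 - C i $ 3) / (fst (d i) - fst (c i))" for i
    define v where "v i = C i $ 3 - u i * fst (c i)" for i
    have seg: "closed_segment (c i) (d i) \<subseteq> proj_pair ` (K i \<inter> line3 (m i) (b i) (u i) (v i))" if i: "i \<in> J" for i
    proof -
      have neq: "fst (d i) - fst (c i) \<noteq> 0"
        using cd i by auto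
      have "m i * (fst (d i) - fst (c i)) = snd (d i) - snd (c i)"
        "u i * (fst (d i) - fst (c i)) = D i $ 3 - C i $ 3"
        using neq by (simp_all add: m_def u_def)
      then have "snd (d i) = m i * fst (d i) + b i" "D i $ 3 = u i * fst (d i) + v i"
        unfolding b_def v_def by (simp_all only: right_diff_distrib)
      then have "C i \<in> line3 (m i) (b i) (u i) (v i)" "D i \<in> line3 (m i) (b i) (u i) (v i)"
        using C D i by (auto simp: line3_def b_def v_def proj_pair_def)
      moreover have "convex (line3 (m i) (b i) (u i) (v i))"
        by (simp add: line3_affine_hull affine_imp_convex)
      moreover have "convex (K i)"
        using convex J(1) i by auto
      ultimately have "closed_segment (C i) (D i) \<subseteq> K i \<inter> line3 (m i) (b i) (u i) (v i)"
        using C D i by (intro closed_segment_subset convex_Int) auto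
      moreover have "closed_segment (c i) (d i) = proj_pair ` closed_segment (C i) (D i)"
        using C D i closed_segment_linear_image[OF linear_proj_pair] by simp
      ultimately show ?thesis
        by blast
    qed
    have "m i \<noteq> m j \<and>
        proj ` (K i \<inter> line3 (m i) (b i) (u i) (v i)) \<inter> proj ` (K j \<inter> line3 (m j) (b j) (u j) (v j)) \<noteq> {}"
      if ij: "i \<in> J" "j \<in> J" "i \<noteq> j" for i j
    proof
      show "m i \<noteq> m j"
        using meet ij by (simp add: m_def)
      have "closed_segment (c i) (d i) \<inter> closed_segment (c j) (d j) \<noteq> {}"
        using meet ij by simp
      then obtain w where w: "w \<in> closed_segment (c i) (d i)" "w \<in> closed_segment (c j) (d j)"
        by blast
      obtain X where X: "X \<in> K i \<inter> line3 (m i) (b i) (u i) (v i)" "w = proj_pair X"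
        using subsetD[OF seg[OF ij(1)] w(1)] by (elim imageE) (rule that)
      obtain Y where Y: "Y \<in> K j \<inter> line3 (m j) (b j) (u j) (v j)" "w = proj_pair Y"
        using subsetD[OF seg[OF ij(2)] w(2)] by (elim imageE) (rule that)
      have "proj_pair X = proj_pair Y"
        using X(2) Y(2) by simp
      with X(1) Y(1) show "proj ` (K i \<inter> line3 (m i) (b i) (u i) (v i)) \<inter> proj ` (K j \<inter> line3 (m j) (b j) (u j) (v j)) \<noteq> {}"
        unfolding proj_pair_eq_iff by blast
    qed
    then show "\<exists>J m b u v. J \<subseteq> {..<N} \<and> card J = n \<and> (\<forall>i\<in>J. \<forall>j\<in>J. i \<noteq> j \<longrightarrow> m i \<noteq> m j \<and>
        proj ` (K i \<inter> line3 (m i) (b i) (u i) (v i)) \<inter> proj ` (K j \<inter> line3 (m j) (b j) (u j) (v j)) \<noteq> {})"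
      using J by (intro exI[of _ J] exI[of _ m] exI[of _ b] exI[of _ u] exI[of _ v]) simp
  qed
qed

section \<open>Caps and cups among planar lines\<close>

text \<open>Quantifying over all abscissae where lines \<open>i\<close> and \<open>k\<close> meet
  avoids a quotient; for distinct slopes there is exactly one. The condition is symmetric in
  \<open>i\<close> and \<open>k\<close>, which allows a sequence to be reversed.\<close>

definition crossing_above :: "(nat \<Rightarrow> real) \<Rightarrow> (nat \<Rightarrow> real) \<Rightarrow> nat \<Rightarrow> nat \<Rightarrow> nat \<Rightarrow> bool" where
  "crossing_above m b i j k \<longleftrightarrow> (\<forall>x. m i * x + b i = m k * x + b k \<longrightarrow> m j * x + b j < m i * x + b i)"

definition crossing_below :: "(nat \<Rightarrow> real) \<Rightarrow> (nat \<Rightarrow> real) \<Rightarrow> nat \<Rightarrow> nat \<Rightarrow> nat \<Rightarrow> bool" where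
  "crossing_below m b i j k \<longleftrightarrow> (\<forall>x. m i * x + b i = m k * x + b k \<longrightarrow> m i * x + b i < m j * x + b j)"

text \<open>The strict inequality also yields \<open>simple_lines\<close>: a point common to three
  lines would not lie strictly above the middle one.\<close>

lemma is_cap_line2:
  assumes "n \<ge> 3" and slopes: "\<And>i j. 1 \<le> i \<Longrightarrow> i < j \<Longrightarrow> j \<le> n \<Longrightarrow> m j < m i"
    and above: "\<And>i j k. 1 \<le> i \<Longrightarrow> i < j \<Longrightarrow> j < k \<Longrightarrow> k \<le> n \<Longrightarrow> crossing_above m b i j k"
  shows "is_cap n (\<lambda>i. line2 (m i) (b i))"
proof -
  have "\<exists>q. line2 (m i) (b i) \<inter> line2 (m k) (b k) = {q} \<and> point_above_line q (line2 (m j) (b j))"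
    if ijk: "1 \<le> i" "i < j" "j < k" "k \<le> n" for i j k
  proof -
    have neq: "m i \<noteq> m k"
      using slopes[of i k] ijk by auto
    define x where "x = (b k - b i) / (m i - m k)"
    have "m i * x + b i = m k * x + b k"
      unfolding lines_meet_iff[OF neq] by (rule x_def)
    then have "m j * x + b j < m i * x + b i"
      using above[OF ijk] by (simp add: crossing_above_def)
    then have "point_above_line (vector [x, m i * x + b i]) (line2 (m j) (b j))"
      unfolding point_above_line_def by (intro bexI[of _ "vector [x, m j * x + b j]"]) (auto simp: line2_def)
    then show ?thesis
      using line2_Int[OF neq, of "b i" "b k"] unfolding x_def by blast
  qed
  moreover have "line2 (m i) (b i) \<inter> line2 (m j) (b j) \<inter> line2 (m k) (b k) = {}"
    if ijk: "1 \<le> i" "i < j" "j < k" "k \<le> n" for i j k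
    using above[OF ijk] by (auto simp: crossing_above_def line2_def)
  ultimately show ?thesis
    using assms by (simp add: is_cap_def simple_lines_def nonvertical_line2_line2 slope_line2)
qed

lemma is_cup_line2:
  assumes "n \<ge> 3" and slopes: "\<And>i j. 1 \<le> i \<Longrightarrow> i < j \<Longrightarrow> j \<le> n \<Longrightarrow> m i < m j"
    and below: "\<And>i j k. 1 \<le> i \<Longrightarrow> i < j \<Longrightarrow> j < k \<Longrightarrow> k \<le> n \<Longrightarrow> crossing_below m b i j k"
  shows "is_cup n (\<lambda>i. line2 (m i) (b i))"
proof -
  have "\<exists>q. line2 (m i) (b i) \<inter> line2 (m k) (b k) = {q} \<and> point_below_line q (line2 (m j) (b j))"
    if ijk: "1 \<le> i" "i < j" "j < k" "k \<le> n" for i j k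
  proof -
    have neq: "m i \<noteq> m k"
      using slopes[of i k] ijk by auto
    define x where "x = (b k - b i) / (m i - m k)"
    have "m i * x + b i = m k * x + b k"
      unfolding lines_meet_iff[OF neq] by (rule x_def)
    then have "m i * x + b i < m j * x + b j"
      using below[OF ijk] by (simp add: crossing_below_def)
    then have "point_below_line (vector [x, m i * x + b i]) (line2 (m j) (b j))"
      unfolding point_below_line_def by (intro bexI[of _ "vector [x, m j * x + b j]"]) (auto simp: line2_def)
    then show ?thesis
      using line2_Int[OF neq, of "b i" "b k"] unfolding x_def by blast
  qed
  moreover have "line2 (m i) (b i) \<inter> line2 (m j) (b j) \<inter> line2 (m k) (b k) = {}"
    if ijk: "1 \<le> i" "i < j" "j < k" "k \<le> n" for i j k
    using below[OF ijk] by (auto simp: crossing_below_def line2_def)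
  ultimately show ?thesis
    using assms by (simp add: is_cup_def simple_lines_def nonvertical_line2_line2 slope_line2)
qed

text \<open>After sorting by increasing slope, triples are coloured by
  \<open>crossing_above\<close>. If it holds, reversing the sequence makes the slopes decrease and
  gives a cap. If it fails, the crossing lies strictly below the middle line, as no three lines
  concur, which gives a cup.\<close>

lemma cap_or_cup_subsequence:
  fixes n :: nat
  shows "\<exists>N. \<forall>m b. inj_on m {..<N} \<and> (\<forall>i<N. \<forall>j<N. \<forall>k<N. i \<noteq> j \<and> i \<noteq> k \<and> j \<noteq> k \<longrightarrow>
       line2 (m i) (b i) \<inter> line2 (m j) (b j) \<inter> line2 (m k) (b k) = {}) \<longrightarrow>
     (\<exists>f. inj_on f {..<n} \<and> (\<forall>i<n. f i < N) \<and>
       ((\<forall>i j. i < j \<and> j < n \<longrightarrow> m (f j) < m (f i)) \<and>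
          (\<forall>i j k. i < j \<and> j < k \<and> k < n \<longrightarrow> crossing_above m b (f i) (f j) (f k)) \<or>
        (\<forall>i j. i < j \<and> j < n \<longrightarrow> m (f i) < m (f j)) \<and>
          (\<forall>i j k. i < j \<and> j < k \<and> k < n \<longrightarrow> crossing_below m b (f i) (f j) (f k))))"
proof -
  obtain N where N: "\<forall>P::nat \<Rightarrow> nat \<Rightarrow> nat \<Rightarrow> bool. \<exists>f b. increasing_into n N f \<and>
     (\<forall>i j k. i < j \<and> j < k \<and> k < n \<longrightarrow> P (f i) (f j) (f k) = b)"
    by (rule exE[OF ramsey_triples])
  show ?thesis
  proof (intro exI[of _ N] allI impI, elim conjE)
    fix m b :: "nat \<Rightarrow> real"
    assume inj: "inj_on m {..<N}" and simple: "\<forall>i<N. \<forall>j<N. \<forall>k<N. i \<noteq> j \<and> i \<noteq> k \<and> j \<noteq> k \<longrightarrow>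
       line2 (m i) (b i) \<inter> line2 (m j) (b j) \<inter> line2 (m k) (b k) = {}"
    obtain s where s: "bij_betw s {..<N} {..<N}"
      and sorted: "\<And>i j. i < j \<Longrightarrow> j < N \<Longrightarrow> m (s i) \<le> m (s j)"
      using ex_sorting_bij[of N m] by blast
    obtain t c where t: "increasing_into n N t"
      and hom: "\<forall>i j k. i < j \<and> j < k \<and> k < n \<longrightarrow> crossing_above m b (s (t i)) (s (t j)) (s (t k)) = c"
      using spec[OF N, of "\<lambda>i j k. crossing_above m b (s i) (s j) (s k)"] by blast
    define g where "g i = s (t i)" for i
    have gN: "\<forall>i<n. g i < N"
      unfolding g_def using bij_betwE[OF s] increasing_intoD(1)[OF t] by auto
    have g_inj: "inj_on g {..<n}"
      unfolding g_def
      by (rule inj_on_lessThan_compose[OF bij_betw_imp_inj_on[OF s] increasing_intoD(3,1)[OF t]])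
    have g_neq: "g i \<noteq> g j" if "i < j" "j < n" for i j
      using inj_onD[OF g_inj, of i j] that by auto
    have m_less: "m (g i) < m (g j)" if "i < j" "j < n" for i j
    proof -
      have "m (g i) \<le> m (g j)"
        unfolding g_def using sorted[of "t i" "t j"] increasing_intoD(1,2)[OF t] that by auto
      moreover have "m (g i) \<noteq> m (g j)"
        using inj_onD[OF inj, of "g i" "g j"] g_neq[OF that] gN that by auto
      ultimately show ?thesis by simp
    qed
    show "\<exists>f. inj_on f {..<n} \<and> (\<forall>i<n. f i < N) \<and>
       ((\<forall>i j. i < j \<and> j < n \<longrightarrow> m (f j) < m (f i)) \<and>
          (\<forall>i j k. i < j \<and> j < k \<and> k < n \<longrightarrow> crossing_above m b (f i) (f j) (f k)) \<or>
        (\<forall>i j. i < j \<and> j < n \<longrightarrow> m (f i) < m (f j)) \<and>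
          (\<forall>i j k. i < j \<and> j < k \<and> k < n \<longrightarrow> crossing_below m b (f i) (f j) (f k)))"
    proof (cases c)
      case True
      define r where "r i = n - Suc i" for i
      have r: "r i < n" "r j < r i" if "i < j" "j < n" for i j
        using that by (auto simp: r_def)
      have r_inj: "inj_on r {..<n}" and r_n: "\<forall>i<n. r i < n"
        by (auto simp: r_def inj_on_def)
      have "inj_on (\<lambda>i. g (r i)) {..<n}"
        by (rule inj_on_lessThan_compose[OF g_inj r_inj r_n])
      moreover have "crossing_above m b (g (r i)) (g (r j)) (g (r k))" if "i < j" "j < k" "k < n" for i j k
      proof -
        have "crossing_above m b (g (r k)) (g (r j)) (g (r i))"
          using hom[rule_format, of "r k" "r j" "r i"] True r that by (simp add: g_def)
        then show ?thesis
          unfolding crossing_above_def by metis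
      qed
      ultimately show ?thesis
        using gN r_n r m_less by (intro exI[of _ "\<lambda>i. g (r i)"]) simp
    next
      case False
      have "crossing_below m b (g i) (g j) (g k)" if ijk: "i < j" "j < k" "k < n" for i j k
        unfolding crossing_below_def
      proof (intro allI impI)
        fix x assume x: "m (g i) * x + b (g i) = m (g k) * x + b (g k)"
        have neq: "m (g i) \<noteq> m (g k)"
          using m_less[of i k] ijk by simp
        \<comment> \<open>Failure of \<open>crossing_above\<close> provides an abscissa
          \<open>y\<close>, which must equal \<open>x\<close> because the slopes differ.\<close>
        obtain y where y: "m (g i) * y + b (g i) = m (g k) * y + b (g k)"
          "\<not> m (g j) * y + b (g j) < m (g i) * y + b (g i)"
          using hom ijk False unfolding crossing_above_def g_def by blast
        have "y = x"
          using x y(1) lines_meet_iff[OF neq] by metis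
        moreover have "m (g j) * x + b (g j) \<noteq> m (g i) * x + b (g i)"
        proof
          assume "m (g j) * x + b (g j) = m (g i) * x + b (g i)"
          then have "vector [x, m (g i) * x + b (g i)] \<in>
            line2 (m (g i)) (b (g i)) \<inter> line2 (m (g j)) (b (g j)) \<inter> line2 (m (g k)) (b (g k))"
            using x by (simp add: line2_def)
          moreover have "line2 (m (g i)) (b (g i)) \<inter> line2 (m (g j)) (b (g j)) \<inter> line2 (m (g k)) (b (g k)) = {}"
            using simple gN g_neq ijk by simp
          ultimately show False
            by blast
        qed
        ultimately show "m (g i) * x + b (g i) < m (g j) * x + b (g j)"
          using y(2) by simp
      qed
      then show ?thesis
        using gN g_inj m_less by (intro exI[of _ g]) simp
    qed
  qed
qed

section \<open>Monotone sequences of lines in space\<close>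

theorem theorem2p3:
  fixes n :: nat
  assumes "n \<ge> 3"
  shows "\<exists>N2::nat. \<forall>\<K>::(real^3) set set.
    finite \<K> \<and> card \<K> = N2 \<and> (\<forall>K\<in>\<K>. convex K) \<and> strictly_2_overlapping \<K> \<longrightarrow>
    (\<exists>(K::nat \<Rightarrow> (real^3) set) (l::nat \<Rightarrow> (real^3) set).
       (\<forall>i\<in>{1..n}. K i \<in> \<K>) \<and> inj_on K {1..n} \<and>
       monotone_lines n l \<and> realized_by n K l)"
proof -
  \<comment> \<open>The bounds are chosen from the last selection backwards: \<open>N1\<close> for
    below or above, \<open>N2\<close> for cap or cup, \<open>N\<close> for pairwise crossing
    lines.\<close>
  obtain N1 where N1: "\<forall>P::nat \<Rightarrow> nat \<Rightarrow> bool. \<exists>f b. increasing_into n N1 f \<and>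
     (\<forall>i j. i < j \<and> j < n \<longrightarrow> P (f i) (f j) = b)"
    by (rule exE[OF ramsey_pairs])
  obtain N2 where N2: "\<forall>m b. inj_on m {..<N2} \<and> (\<forall>i<N2. \<forall>j<N2. \<forall>k<N2. i \<noteq> j \<and> i \<noteq> k \<and> j \<noteq> k \<longrightarrow>
       line2 (m i) (b i) \<inter> line2 (m j) (b j) \<inter> line2 (m k) (b k) = {}) \<longrightarrow>
     (\<exists>f. inj_on f {..<N1} \<and> (\<forall>i<N1. f i < N2) \<and>
       ((\<forall>i j. i < j \<and> j < N1 \<longrightarrow> m (f j) < m (f i)) \<and>
          (\<forall>i j k. i < j \<and> j < k \<and> k < N1 \<longrightarrow> crossing_above m b (f i) (f j) (f k)) \<or>
        (\<forall>i j. i < j \<and> j < N1 \<longrightarrow> m (f i) < m (f j)) \<and>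
          (\<forall>i j k. i < j \<and> j < k \<and> k < N1 \<longrightarrow> crossing_below m b (f i) (f j) (f k))))"
    by (rule exE[OF cap_or_cup_subsequence])
  obtain N where N: "\<forall>K. (\<forall>i<N. convex (K i)) \<and> convex_family N (\<lambda>i. proj_pair ` K i) \<longrightarrow>
     (\<exists>J m b u v. J \<subseteq> {..<N} \<and> card J = N2 \<and> (\<forall>i\<in>J. \<forall>j\<in>J. i \<noteq> j \<longrightarrow> m i \<noteq> m j \<and>
        proj ` (K i \<inter> line3 (m i) (b i) (u i) (v i)) \<inter> proj ` (K j \<inter> line3 (m j) (b j) (u j) (v j)) \<noteq> {}))"
    by (rule exE[OF pairwise_crossing_lines])
  show ?thesis
  proof (intro exI[of _ N] allI impI, elim conjE)
    fix \<K> :: "(real^3) set set"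
    assume fin: "finite \<K>" and card: "card \<K> = N" and convex: "\<forall>K\<in>\<K>. convex K"
      and overlap: "strictly_2_overlapping \<K>"
    obtain F where F: "bij_betw F {..<N} \<K>"
      using ex_bij_betw_nat_finite[OF fin] card by (auto simp: atLeast0LessThan)
    have F_mem: "F i \<in> \<K>" if "i < N" for i
      using bij_betwE[OF F] that by simp
    have F_neq: "F i \<noteq> F j" if "i < N" "j < N" "i \<noteq> j" for i j
      using inj_onD[OF bij_betw_imp_inj_on[OF F], of i j] that by auto
    have no_triple: "proj ` F i \<inter> proj ` F j \<inter> proj ` F k = {}"
      if "i < N" "j < N" "k < N" "i \<noteq> j" "i \<noteq> k" "j \<noteq> k" for i j k
      using overlap F_mem F_neq that unfolding strictly_2_overlapping_def strictly_2_intersecting_def by simp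
    have convexF: "\<forall>i<N. convex (F i)"
      using convex F_mem by blast
    have "proj_pair ` F i \<inter> proj_pair ` F j \<noteq> {}" if ij: "i < N" "j < N" "i \<noteq> j" for i j
    proof -
      have "proj ` F i \<inter> proj ` F j \<noteq> {}"
        using overlap F_mem F_neq ij unfolding strictly_2_overlapping_def strictly_2_intersecting_def by simp
      then obtain p q where "p \<in> F i" "q \<in> F j" "proj p = proj q"
        by blast
      then show ?thesis
        unfolding proj_pair_eq_iff[symmetric] by blast
    qed
    moreover have "proj_pair ` F i \<inter> proj_pair ` F j \<inter> proj_pair ` F k = {}"
      if ijk: "i < N" "j < N" "k < N" "i \<noteq> j" "i \<noteq> k" "j \<noteq> k" for i j k
    proof (rule ccontr)
      assume "\<not> ?thesis"
      then obtain w where "w \<in> proj_pair ` F i" "w \<in> proj_pair ` F j" "w \<in> proj_pair ` F k"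
        by blast
      then obtain p q r where "p \<in> F i" "q \<in> F j" "r \<in> F k" "proj_pair p = proj_pair q" "proj_pair p = proj_pair r"
        by (metis imageE)
      then have "proj p \<in> proj ` F i \<inter> proj ` F j \<inter> proj ` F k"
        unfolding proj_pair_eq_iff by (metis IntI image_eqI)
      then show False
        using no_triple[OF ijk] by blast
    qed
    ultimately have fam: "convex_family N (\<lambda>i. proj_pair ` F i)"
      using convexF unfolding convex_family_def strictly_2_intersecting_def
      by (simp add: convex_linear_image[OF linear_proj_pair])
    obtain J m b u v where J: "J \<subseteq> {..<N}" "card J = N2" and
      crossing: "\<forall>i\<in>J. \<forall>j\<in>J. i \<noteq> j \<longrightarrow> m i \<noteq> m j \<and>
        proj ` (F i \<inter> line3 (m i) (b i) (u i) (v i)) \<inter> proj ` (F j \<inter> line3 (m j) (b j) (u j) (v j)) \<noteq> {}"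
      using mp[OF spec[OF N] conjI[OF convexF fam]] by (elim exE conjE) (rule that)
    \<comment> \<open>Two projected lines have only one common point, and the projected chords share
      a point, so this is the same point and lies in both projected sets. Three concurrent lines
      would therefore violate \<open>no_triple\<close>.\<close>
    have crossing_mem: "q \<in> proj ` F i \<inter> proj ` F j"
      if ij: "i \<in> J" "j \<in> J" "i \<noteq> j" and q: "q \<in> line2 (m i) (b i)" "q \<in> line2 (m j) (b j)" for i j q
    proof -
      have neq: "m i \<noteq> m j"
        using crossing ij by blast
      obtain w where w: "w \<in> proj ` (F i \<inter> line3 (m i) (b i) (u i) (v i))" "w \<in> proj ` (F j \<inter> line3 (m j) (b j) (u j) (v j))"
        using crossing ij by blast
      then have "w \<in> line2 (m i) (b i) \<inter> line2 (m j) (b j)"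
        using proj_line3 by blast
      then have "w = q"
        using q line2_Int[OF neq, of "b i" "b j"] by (metis IntI singletonD)
      then show ?thesis
        using w by blast
    qed
    have simple: "line2 (m i) (b i) \<inter> line2 (m j) (b j) \<inter> line2 (m k) (b k) = {}"
      if ijk: "i \<in> J" "j \<in> J" "k \<in> J" "i \<noteq> j" "i \<noteq> k" "j \<noteq> k" for i j k
    proof (rule ccontr)
      assume "\<not> ?thesis"
      then obtain q where "q \<in> line2 (m i) (b i)" "q \<in> line2 (m j) (b j)" "q \<in> line2 (m k) (b k)"
        by blast
      then have "q \<in> proj ` F i \<inter> proj ` F j \<inter> proj ` F k"
        using crossing_mem[of i j q] crossing_mem[of i k q] ijk by blast
      then show False
        using no_triple[of i j k] ijk J(1) by blast
    qed
    obtain e where e: "bij_betw e {..<N2} J"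
      using ex_bij_betw_nat_finite[of J] J finite_subset[OF J(1)] by (auto simp: atLeast0LessThan)
    have e_mem: "e i \<in> J" if "i < N2" for i
      using bij_betwE[OF e] that by simp
    have e_neq: "e i \<noteq> e j" if "i < N2" "j < N2" "i \<noteq> j" for i j
      using inj_onD[OF bij_betw_imp_inj_on[OF e], of i j] that by auto
    have inj_m: "inj_on (\<lambda>i. m (e i)) {..<N2}"
      using crossing e_mem e_neq by (intro inj_onI) (metis lessThan_iff)
    have simple_e: "\<forall>i<N2. \<forall>j<N2. \<forall>k<N2. i \<noteq> j \<and> i \<noteq> k \<and> j \<noteq> k \<longrightarrow>
       line2 (m (e i)) (b (e i)) \<inter> line2 (m (e j)) (b (e j)) \<inter> line2 (m (e k)) (b (e k)) = {}"
      using simple e_mem e_neq by simp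
    obtain f where f: "inj_on f {..<N1}" "\<forall>i<N1. f i < N2"
      and cap_cup: "(\<forall>i j. i < j \<and> j < N1 \<longrightarrow> m (e (f j)) < m (e (f i))) \<and>
          (\<forall>i j k. i < j \<and> j < k \<and> k < N1 \<longrightarrow> crossing_above (\<lambda>i. m (e i)) (\<lambda>i. b (e i)) (f i) (f j) (f k)) \<or>
        (\<forall>i j. i < j \<and> j < N1 \<longrightarrow> m (e (f i)) < m (e (f j))) \<and>
          (\<forall>i j k. i < j \<and> j < k \<and> k < N1 \<longrightarrow> crossing_below (\<lambda>i. m (e i)) (\<lambda>i. b (e i)) (f i) (f j) (f k))"
      using mp[OF spec[OF spec[OF N2]] conjI[OF inj_m simple_e]] by (elim exE conjE) (rule that)
    define L where "L i = line3 (m i) (b i) (u i) (v i)" for i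
    \<comment> \<open>The cap and cup conditions pass to subsequences, so this last selection
      preserves them.\<close>
    obtain t c where t: "increasing_into n N1 t"
      and hom: "\<forall>i j. i < j \<and> j < n \<longrightarrow> line_below_eq (L (e (f (t i)))) (L (e (f (t j)))) = c"
      using spec[OF N1, of "\<lambda>i j. line_below_eq (L (e (f i))) (L (e (f j)))"] by blast
    \<comment> \<open>The selections count from 0, the sequences in the conclusion from 1.\<close>
    define g where "g i = e (f (t (i - 1)))" for i
    have t_less: "t (i - 1) < t (j - 1)" "t (j - 1) < N1" if "1 \<le> i" "i < j" "j \<le> n" for i j
    proof -
      have "i - 1 < j - 1" "j - 1 < n"
        using that by auto
      then show "t (i - 1) < t (j - 1)" "t (j - 1) < N1"
        using increasing_intoD(1,2)[OF t] by auto
    qed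
    have g_mem: "g i \<in> J" if "1 \<le> i" "i \<le> n" for i
      unfolding g_def using e_mem f(2) increasing_intoD(1)[OF t] that by simp
    have g_neq: "g i \<noteq> g j" if "1 \<le> i" "i < j" "j \<le> n" for i j
    proof -
      have "f (t (i - 1)) \<noteq> f (t (j - 1))"
        using inj_onD[OF f(1), of "t (i - 1)" "t (j - 1)"] t_less[OF that] by auto
      then show ?thesis
        unfolding g_def using e_neq f(2) t_less[OF that] by simp
    qed
    have m_neq: "m (g i) \<noteq> m (g j)" if "1 \<le> i" "i < j" "j \<le> n" for i j
      using crossing g_mem g_neq that by simp
    have "is_cap n (\<lambda>i. line2 (m (g i)) (b (g i))) \<or> is_cup n (\<lambda>i. line2 (m (g i)) (b (g i)))"
      using cap_cup
    proof (elim disjE conjE)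
      assume slopes: "\<forall>i j. i < j \<and> j < N1 \<longrightarrow> m (e (f j)) < m (e (f i))"
        and above: "\<forall>i j k. i < j \<and> j < k \<and> k < N1 \<longrightarrow> crossing_above (\<lambda>i. m (e i)) (\<lambda>i. b (e i)) (f i) (f j) (f k)"
      have "is_cap n (\<lambda>i. line2 (m (g i)) (b (g i)))"
      proof (rule is_cap_line2[OF assms])
        show "m (g j) < m (g i)" if "1 \<le> i" "i < j" "j \<le> n" for i j
          unfolding g_def using slopes t_less[OF that] by blast
        show "crossing_above (\<lambda>i. m (g i)) (\<lambda>i. b (g i)) i j k" if "1 \<le> i" "i < j" "j < k" "k \<le> n" for i j k
          using above t_less[of i j] t_less[of j k] that unfolding crossing_above_def g_def by simp
      qed
      then show ?thesis ..
    next
      assume slopes: "\<forall>i j. i < j \<and> j < N1 \<longrightarrow> m (e (f i)) < m (e (f j))"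
        and below: "\<forall>i j k. i < j \<and> j < k \<and> k < N1 \<longrightarrow> crossing_below (\<lambda>i. m (e i)) (\<lambda>i. b (e i)) (f i) (f j) (f k)"
      have "is_cup n (\<lambda>i. line2 (m (g i)) (b (g i)))"
      proof (rule is_cup_line2[OF assms])
        show "m (g i) < m (g j)" if "1 \<le> i" "i < j" "j \<le> n" for i j
          unfolding g_def using slopes t_less[OF that] by blast
        show "crossing_below (\<lambda>i. m (g i)) (\<lambda>i. b (g i)) i j k" if "1 \<le> i" "i < j" "j < k" "k \<le> n" for i j k
          using below t_less[of i j] t_less[of j k] that unfolding crossing_below_def g_def by simp
      qed
      then show ?thesis ..
    qed
    moreover have "(\<forall>i\<in>{1..<n}. line_below_eq (L (g i)) (L (g (i + 1)))) \<or>
      (\<forall>i\<in>{1..<n}. line_above_eq (L (g i)) (L (g (i + 1))))"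
    proof (cases c)
      case True
      then have "\<forall>i\<in>{1..<n}. line_below_eq (L (g i)) (L (g (i + 1)))"
        using hom by (simp add: g_def)
      then show ?thesis ..
    next
      case False
      \<comment> \<open>By totality, consecutive lines not related by \<open>line_below_eq\<close>
        are related by \<open>line_above_eq\<close>.\<close>
      have "line_above_eq (L (g i)) (L (g (i + 1)))" if "i \<in> {1..<n}" for i
      proof -
        have "\<not> line_below_eq (L (g i)) (L (g (i + 1)))"
          using hom False that by (simp add: g_def)
        moreover have "m (g i) \<noteq> m (g (i + 1))"
          using m_neq that by simp
        ultimately show ?thesis
          using line_below_eq_or_above_eq unfolding L_def by blast
      qed
      then show ?thesis by blast
    qed
    ultimately have monotone: "monotone_lines n (\<lambda>i. L (g i))"
      using assms by (simp add: monotone_lines_def L_def proj_line3 nonvertical_line3_line3)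
    have realized: "realized_by n (\<lambda>i. F (g i)) (\<lambda>i. L (g i))"
      using crossing g_mem g_neq m_neq not_affine_parallel_line2
      by (simp add: realized_by_def L_def proj_line3 nonvertical_line3_line3)
    have "F (g i) \<noteq> F (g j)" if "1 \<le> i" "i < j" "j \<le> n" for i j
    proof (rule F_neq)
      show "g i < N" "g j < N"
        using g_mem[of i] g_mem[of j] J(1) that by auto
    qed (rule g_neq[OF that])
    then have "inj_on (\<lambda>i. F (g i)) {1..n}"
      by (intro linorder_inj_onI) auto
    moreover have "\<forall>i\<in>{1..n}. F (g i) \<in> \<K>"
      using F_mem g_mem subsetD[OF J(1)] by simp
    ultimately show "\<exists>(K::nat \<Rightarrow> (real^3) set) (l::nat \<Rightarrow> (real^3) set).
       (\<forall>i\<in>{1..n}. K i \<in> \<K>) \<and> inj_on K {1..n} \<and> monotone_lines n l \<and> realized_by n K l"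
      using monotone realized by (intro exI[of _ "\<lambda>i. F (g i)"] exI[of _ "\<lambda>i. L (g i)"]) simp
  qed
qed

end
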